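(* Let $U$ be a continuous convex (real-valued) function on $[0,\infty)$ with $U(0)=0$. Let $(X,d)$ be a compact metric space equipped with a Borel probability measure $\nu$. Let $\mu\in P_2(X,\nu)$ satisfy $U_\nu(\mu)<\infty$. Then there is a sequence $\{f_k\}_{k=1}^\infty$ in $C(X)$, with each $f_k\nu$ a probability measure, such that $\lim_{k\to\infty}f_k\nu=\mu$ in the weak-$*$ topology and $\lim_{k\to\infty}U_\nu(f_k\nu)=U_\nu(\mu)$.
   Context: $P_2(X,\nu)$ is the set of Borel probability measures $\mu$ on $X$ with $\mathrm{supp}(\mu)\subset\mathrm{supp}(\nu)$. $C(X)$ is the space of continuous real-valued functions on $X$; weak-$*$ convergence is convergence against all functions in $C(X)$. For a Borel probability measure $\mu$ on $X$ with Lebesgue decomposition $\mu=\rho\nu+\mu_s$ with respect to $\nu$, $U_\nu(\mu)=\int_X U(\rho)\,d\nu+U'(\infty)\mu_s(X)\in\mathbb{R}\cup\{\infty\}$, where $U'(\infty)=\lim_{r\to\infty}U(r)/r$ and $\infty\cdot0=0$. *)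

theory Defs
  imports "HOL-Probability.Probability"
begin

definition msupport :: "'a::topological_space measure \<Rightarrow> 'a set" where
  "msupport \<mu> = {x. \<forall>S. open S \<and> x \<in> S \<longrightarrow> 0 < emeasure \<mu> S}"

definition P2 :: "'a::topological_space measure \<Rightarrow> 'a measure set" where
  "P2 \<nu> = {\<mu>. prob_space \<mu> \<and> sets \<mu> = sets borel \<and> msupport \<mu> \<subseteq> msupport \<nu>}"

definition weak_star_conv :: "(nat \<Rightarrow> 'a::topological_space measure) \<Rightarrow> 'a measure \<Rightarrow> bool" where
  "weak_star_conv M \<mu> \<longleftrightarrow>
     (\<forall>\<phi>::'a \<Rightarrow> real. continuous_on UNIV \<phi> \<longrightarrow>
        (\<lambda>k. integral\<^sup>L (M k) \<phi>) \<longlonglongrightarrow> integral\<^sup>L \<mu> \<phi>)"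

definition mutually_singular :: "'a measure \<Rightarrow> 'a measure \<Rightarrow> bool" where
  "mutually_singular \<nu> \<mu> \<longleftrightarrow>
     (\<exists>N\<in>sets \<nu>. emeasure \<nu> N = 0 \<and> emeasure \<mu> (space \<nu> - N) = 0)"

definition lebesgue_decomposition ::
  "'a measure \<Rightarrow> 'a measure \<Rightarrow> ('a \<Rightarrow> real) \<Rightarrow> 'a measure \<Rightarrow> bool" where
  "lebesgue_decomposition \<nu> \<mu> \<rho> \<mu>s \<longleftrightarrow>
     \<rho> \<in> borel_measurable \<nu> \<and> (\<forall>x. 0 \<le> \<rho> x) \<and>
     sets \<mu>s = sets \<nu> \<and> mutually_singular \<nu> \<mu>s \<and>
     (\<forall>A\<in>sets \<nu>. emeasure \<mu> A = emeasure (density \<nu> (\<lambda>x. ennreal (\<rho> x))) A + emeasure \<mu>s A)"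

text \<open>An integral with values in the extended reals. It is the usual one as soon as the positive
  or the negative part of the integrand has finite integral. For convex \<open>U\<close> and an integrable
  density \<open>\<rho>\<close> the negative part of \<open>U \<circ> \<rho>\<close> does, because \<open>U\<close> is bounded below by an affine
  function.\<close>

definition ereal_integral :: "'a measure \<Rightarrow> ('a \<Rightarrow> real) \<Rightarrow> ereal" where
  "ereal_integral M g =
     enn2ereal (\<integral>\<^sup>+x. ennreal (g x) \<partial>M) - enn2ereal (\<integral>\<^sup>+x. ennreal (- g x) \<partial>M)"

definition slope_at_infinity :: "(real \<Rightarrow> real) \<Rightarrow> ereal" where
  "slope_at_infinity U = Lim at_top (\<lambda>r. ereal (U r / r))"

text \<open>Products in \<^typ>\<open>ereal\<close> satisfy \<open>\<infinity> * 0 = 0\<close>. The definite description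
  is justified by the two lemmas below: a Lebesgue decomposition exists, and any two of
  them give the same value.\<close>

definition U_functional :: "(real \<Rightarrow> real) \<Rightarrow> 'a measure \<Rightarrow> 'a measure \<Rightarrow> ereal" where
  "U_functional U \<nu> \<mu> =
     (THE u. \<exists>\<rho> \<mu>s. lebesgue_decomposition \<nu> \<mu> \<rho> \<mu>s \<and>
        u = ereal_integral \<nu> (\<lambda>x. U (\<rho> x))
            + slope_at_infinity U * enn2ereal (emeasure \<mu>s (space \<nu>)))"

lemma lebesgue_decomposition_exists:
  assumes "finite_measure \<nu>" "finite_measure \<mu>" and sets: "sets \<mu> = sets \<nu>"
  shows "\<exists>\<rho> \<mu>s. lebesgue_decomposition \<nu> \<mu> \<rho> \<mu>s"
proof -
  interpret \<nu>: finite_measure \<nu> by fact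
  interpret \<mu>: finite_measure \<mu> by fact
  define s where "s = (SUP N\<in>null_sets \<nu>. emeasure \<mu> N)"
  have "null_sets \<nu> \<noteq> {}" by auto
  from ennreal_SUP_countable_SUP[OF this, of "emeasure \<mu>"]
  obtain g :: "nat \<Rightarrow> ennreal" where g: "range g \<subseteq> emeasure \<mu> ` null_sets \<nu>" "s = Sup (range g)"
    unfolding s_def by blast
  then have "\<forall>i. \<exists>N\<in>null_sets \<nu>. g i = emeasure \<mu> N" by blast
  then obtain F where F: "\<And>i::nat. F i \<in> null_sets \<nu>" "\<And>i. g i = emeasure \<mu> (F i)" by metis
  define N where "N = (\<Union>i. F i)"
  have N: "N \<in> null_sets \<nu>" unfolding N_def using F(1) by (rule null_sets_UN)
  then have NS: "N \<in> sets \<nu>" "N \<in> sets \<mu>" by (auto simp: sets)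
  have "g i \<le> emeasure \<mu> N" for i
    unfolding F(2) by (rule emeasure_mono) (use NS N_def in auto)
  then have sN: "s \<le> emeasure \<mu> N" unfolding g(2) by (auto intro: SUP_least)
  have AN: "emeasure \<mu> (A - N) = 0" if A: "A \<in> null_sets \<nu>" for A
  proof -
    have AS: "A \<in> sets \<mu>" using A by (auto simp: sets)
    have "A \<union> N \<in> null_sets \<nu>" using A N by auto
    then have "emeasure \<mu> (N \<union> (A - N)) \<le> s"
      unfolding s_def by (metis SUP_upper Un_Diff_cancel sup_commute)
    also note sN
    also have "emeasure \<mu> (N \<union> (A - N)) = emeasure \<mu> N + emeasure \<mu> (A - N)"
      by (rule plus_emeasure[symmetric]) (use AS NS in auto)
    finally have "emeasure \<mu> N + emeasure \<mu> (A - N) \<le> emeasure \<mu> N + 0" unfolding add_0_right .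
    then show ?thesis
      by (metis \<mu>.emeasure_finite ennreal_add_left_cancel_le infinity_ennreal_def le_zero_eq)
  qed
  define \<mu>a where "\<mu>a = density \<mu> (indicator (space \<nu> - N))"
  define \<mu>s where "\<mu>s = density \<mu> (indicator N)"
  have sp: "space \<mu> = space \<nu>" using sets by (rule sets_eq_imp_space_eq)
  have ea: "emeasure \<mu>a A = emeasure \<mu> (A - N)" if "A \<in> sets \<nu>" for A
  proof -
    have "emeasure \<mu>a A = emeasure \<mu> ((space \<nu> - N) \<inter> A)"
      unfolding \<mu>a_def by (rule emeasure_restricted) (use that NS(1) in \<open>auto simp: sets\<close>)
    also have "(space \<nu> - N) \<inter> A = A - N" using sets.sets_into_space[OF that] by auto
    finally show ?thesis .
  qed
  have es: "emeasure \<mu>s A = emeasure \<mu> (A \<inter> N)" if "A \<in> sets \<nu>" for A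
    unfolding \<mu>s_def
    by (subst emeasure_restricted) (use that NS(1) in \<open>auto simp: sets Int_commute\<close>)
  have sa: "sets \<mu>a = sets \<nu>" and ss: "sets \<mu>s = sets \<nu>" by (auto simp: \<mu>a_def \<mu>s_def sets)
  have fa: "finite_measure \<mu>a"
    using ea[OF sets.top] \<mu>.emeasure_finite sets_eq_imp_space_eq[OF sa]
    by (intro finite_measureI) simp
  then have "absolutely_continuous \<nu> \<mu>a"
    unfolding absolutely_continuous_def using AN ea sa by (auto simp: null_sets_def)
  from \<nu>.Radon_Nikodym_finite_measure[OF fa sa this]
  obtain h where h: "h \<in> borel_measurable \<nu>" "density \<nu> h = \<mu>a" by auto
  have "integral\<^sup>N \<nu> h = emeasure \<mu>a (space \<nu>)"
    using h by (simp add: emeasure_density flip: h(2))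
  also have "\<dots> \<noteq> \<infinity>" using ea[OF sets.top] \<mu>.emeasure_finite by simp
  finally have "AE x in \<nu>. h x \<noteq> \<infinity>" using h by (intro nn_integral_PInf_AE)
  then have "AE x in \<nu>. ennreal (enn2real (h x)) = h x"
    by eventually_elim (simp add: top.not_eq_extremum)
  then have hd: "density \<nu> (\<lambda>x. ennreal (enn2real (h x))) = \<mu>a"
    using h by (subst h(2)[symmetric], intro density_cong) auto
  have "emeasure \<mu> A = emeasure \<mu>a A + emeasure \<mu>s A" if "A \<in> sets \<nu>" for A
  proof -
    have "emeasure \<mu> (A - N) + emeasure \<mu> (A \<inter> N) = emeasure \<mu> ((A - N) \<union> (A \<inter> N))"
      by (rule plus_emeasure) (use that NS in \<open>auto simp: sets\<close>)
    also have "(A - N) \<union> (A \<inter> N) = A" by auto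
    finally show ?thesis using ea es that by simp
  qed
  moreover have "mutually_singular \<nu> \<mu>s"
    unfolding mutually_singular_def
    by (rule bexI[of _ N]) (use N NS es[of "space \<nu> - N"] in \<open>auto simp: Diff_Int_distrib2\<close>)
  ultimately have "lebesgue_decomposition \<nu> \<mu> (\<lambda>x. enn2real (h x)) \<mu>s"
    unfolding lebesgue_decomposition_def using h ss by (auto simp: hd)
  then show ?thesis by blast
qed

lemma U_functional_eq:
  assumes "finite_measure \<nu>" "finite_measure \<mu>"
    and dec: "lebesgue_decomposition \<nu> \<mu> \<rho> \<mu>s"
  shows "U_functional U \<nu> \<mu> = ereal_integral \<nu> (\<lambda>x. U (\<rho> x))
            + slope_at_infinity U * enn2ereal (emeasure \<mu>s (space \<nu>))"
proof -
  interpret \<nu>: finite_measure \<nu> by fact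
  interpret \<mu>: finite_measure \<mu> by fact
  have key: "(AE x in \<nu>. \<rho>1 x = \<rho>2 x) \<and> emeasure \<mu>1 (space \<nu>) = emeasure \<mu>2 (space \<nu>)"
    if d1: "lebesgue_decomposition \<nu> \<mu> \<rho>1 \<mu>1" and d2: "lebesgue_decomposition \<nu> \<mu> \<rho>2 \<mu>2"
    for \<rho>1 \<rho>2 \<mu>1 \<mu>2
  proof -
    from d1 obtain N1 where N1: "N1 \<in> null_sets \<nu>" "emeasure \<mu>1 (space \<nu> - N1) = 0"
      unfolding lebesgue_decomposition_def mutually_singular_def by (auto simp: null_sets_def)
    from d2 obtain N2 where N2: "N2 \<in> null_sets \<nu>" "emeasure \<mu>2 (space \<nu> - N2) = 0"
      unfolding lebesgue_decomposition_def mutually_singular_def by (auto simp: null_sets_def)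
    define N where "N = N1 \<union> N2"
    have N: "N \<in> null_sets \<nu>" using N1 N2 by (auto simp: N_def)
    have d: "emeasure (density \<nu> (\<lambda>x. ennreal (\<rho> x))) A = emeasure \<mu> (A - N) \<and>
        emeasure \<mu>' (space \<nu>) = emeasure \<mu> N"
      if dec': "lebesgue_decomposition \<nu> \<mu> \<rho> \<mu>'" and M: "M \<in> sets \<nu>" "M \<subseteq> N" "emeasure \<mu>' (space \<nu> - M) = 0"
        and A: "A \<in> sets \<nu>" for A \<rho> \<mu>' M
    proof -
      have \<rho>: "\<rho> \<in> borel_measurable \<nu>" and s': "sets \<mu>' = sets \<nu>"
        and eq: "\<And>A. A \<in> sets \<nu> \<Longrightarrow>
          emeasure \<mu> A = emeasure (density \<nu> (\<lambda>x. ennreal (\<rho> x))) A + emeasure \<mu>' A"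
        using dec' by (auto simp: lebesgue_decomposition_def)
      let ?D = "density \<nu> (\<lambda>x. ennreal (\<rho> x))"
      have NS: "N \<in> sets \<nu>" using N by auto
      have DN: "N \<in> null_sets ?D"
        using N \<rho> absolutely_continuousI_density[of "\<lambda>x. ennreal (\<rho> x)" \<nu>]
        by (auto simp: absolutely_continuous_def)
      have Mn: "space \<nu> - M \<in> null_sets \<mu>'" using M s' by (auto simp: null_sets_def)
      have "emeasure \<mu>' (A - N) = 0"
        using null_sets_subset[OF Mn, of "A - N"] A NS M s' sets.sets_into_space[OF A] by auto
      then have 1: "emeasure \<mu> (A - N) = emeasure ?D (A - N)" using eq[of "A - N"] A NS by simp
      have 2: "emeasure ?D (A - N) = emeasure ?D A"
        by (rule emeasure_Diff_null_set[OF DN]) (use A in simp)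
      have "emeasure \<mu>' (space \<nu> - (space \<nu> - N)) = emeasure \<mu>' (space \<nu>)"
        by (rule emeasure_Diff_null_set)
           (use null_sets_subset[OF Mn, of "space \<nu> - N"] M NS s' in auto)
      moreover have "space \<nu> - (space \<nu> - N) = N" using sets.sets_into_space[OF NS] by auto
      moreover have "emeasure \<mu> N = emeasure \<mu>' N" using eq[OF NS] DN by auto
      ultimately show ?thesis using 1 2 by simp
    qed
    have m1: "N1 \<in> sets \<nu>" "N1 \<subseteq> N" and m2: "N2 \<in> sets \<nu>" "N2 \<subseteq> N"
      using N1 N2 by (auto simp: N_def)
    note e1 = d[OF d1 m1 N1(2)] and e2 = d[OF d2 m2 N2(2)]
    have r: "\<rho>1 \<in> borel_measurable \<nu>" "\<rho>2 \<in> borel_measurable \<nu>" "\<forall>x. 0 \<le> \<rho>1 x" "\<forall>x. 0 \<le> \<rho>2 x"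
      using d1 d2 by (auto simp: lebesgue_decomposition_def)
    have "density \<nu> (\<lambda>x. ennreal (\<rho>1 x)) = density \<nu> (\<lambda>x. ennreal (\<rho>2 x))"
      by (rule measure_eqI) (use e1 e2 in auto)
    then have "AE x in \<nu>. ennreal (\<rho>1 x) = ennreal (\<rho>2 x)"
      using r by (subst (asm) \<nu>.density_unique_iff) auto
    then have "AE x in \<nu>. \<rho>1 x = \<rho>2 x" using r by simp
    then show ?thesis using e1[OF sets.top] e2[OF sets.top] by simp
  qed
  show ?thesis
    unfolding U_functional_def
  proof (rule the_equality)
    fix u
    assume "\<exists>\<rho>' \<mu>s'. lebesgue_decomposition \<nu> \<mu> \<rho>' \<mu>s' \<and>
        u = ereal_integral \<nu> (\<lambda>x. U (\<rho>' x))
            + slope_at_infinity U * enn2ereal (emeasure \<mu>s' (space \<nu>))"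
    then obtain \<rho>' \<mu>s' where d': "lebesgue_decomposition \<nu> \<mu> \<rho>' \<mu>s'"
      and u: "u = ereal_integral \<nu> (\<lambda>x. U (\<rho>' x))
            + slope_at_infinity U * enn2ereal (emeasure \<mu>s' (space \<nu>))" by blast
    from key[OF d' dec] have ae: "AE x in \<nu>. \<rho>' x = \<rho> x"
      and es: "emeasure \<mu>s' (space \<nu>) = emeasure \<mu>s (space \<nu>)" by auto
    have "(\<integral>\<^sup>+x. ennreal (U (\<rho>' x)) \<partial>\<nu>) = (\<integral>\<^sup>+x. ennreal (U (\<rho> x)) \<partial>\<nu>)"
      "(\<integral>\<^sup>+x. ennreal (- U (\<rho>' x)) \<partial>\<nu>) = (\<integral>\<^sup>+x. ennreal (- U (\<rho> x)) \<partial>\<nu>)"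
      by (rule nn_integral_cong_AE, use ae in eventually_elim, simp)+
    then show "u = ereal_integral \<nu> (\<lambda>x. U (\<rho> x))
            + slope_at_infinity U * enn2ereal (emeasure \<mu>s (space \<nu>))"
      unfolding u es ereal_integral_def by simp
  qed (use dec in blast)
qed

end

theory Submission
  imports Defs
begin

text \<open>
  Smooth \<open>\<mu>\<close> with a partition of unity \<open>(\<psi> i)\<close> of mesh \<open>1/k\<close>: the density
  \<open>f = (\<Sum>i. \<psi> i * \<mu>(\<psi> i) / \<nu>(\<psi> i))\<close> is continuous, \<open>f \<nu>\<close> is close to \<open>\<mu>\<close>, and Jensen's
  inequality gives \<open>U(f \<nu>) \<le> U(\<mu>)\<close>. For the reverse inequality in the limit, \<open>U\<close> is the supremum of
  countably many affine functions \<open>s \<mapsto> a s + b\<close>, and the supremum of their slopes is the slope at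
  infinity. So \<open>U(\<mu>)\<close> is the supremum of \<open>\<integral>\<alpha> d\<mu> + \<integral>\<beta> d\<nu>\<close> over measurable families of
  such lines, where \<open>\<alpha>\<close> and \<open>\<beta>\<close> can be taken continuous by approximation in mean; each
  of these values is a weak-* continuous lower bound of \<open>U\<close>.
\<close>

section \<open>Affine minorants of a convex function\<close>

text \<open>Both inequalities rest on one picture: for masses \<open>m\<close> and
  \<open>v > 0\<close>, \<open>v * U (m / v)\<close> is the supremum of \<open>a * m + b * v\<close>
  over the affine minorants \<open>(a, b)\<close>, and where \<open>v\<close> vanishes only the
  slope \<open>a\<close> is left, with supremum the slope at infinity. Regular and singular part of
  \<mu> are thus treated alike. The obstacle lies in the lower bound: the best line varies with the
  point, and only measurably. Approximating slope and intercept separately by continuous functions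
  would destroy \<open>a * s + b \<le> U s\<close>. But the minorants form a convex set, so a choice
  between two families on a Borel set can be blurred by one continuous weight with values in [0,1],
  applied to both coefficients. Slopes are paired with \<mu> and intercepts with \<nu>, hence this
  weight must be close to the indicator in mean for both measures at once. The hypothesis on the
  supports enters where a piece of the partition has \<nu>-mass zero: its \<mu>-mass must vanish
  too.\<close>

definition affine_minorants :: "(real \<Rightarrow> real) \<Rightarrow> (real \<times> real) set" where
  "affine_minorants U = {(a, b). \<forall>s\<ge>0. a * s + b \<le> U s}"

lemma affine_minorantsD: "(a, b) \<in> affine_minorants U \<Longrightarrow> 0 \<le> s \<Longrightarrow> a * s + b \<le> U s"
  by (auto simp: affine_minorants_def)

text \<open>Positivity of \<open>r\<close> matters: at the end point 0 the slope of \<open>U\<close>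
  can be minus infinity, as for \<open>- sqrt s\<close>, and then no supporting line exists
  there.\<close>

lemma convex_on_subgradient:
  fixes U :: "real \<Rightarrow> real"
  assumes "convex_on {0..} U" "0 < r"
  obtains p where "(p, U r - p * r) \<in> affine_minorants U"
proof
  \<comment> \<open>The right derivative at \<open>r\<close>, as the infimum of the difference
    quotients to the right of \<open>r\<close>.\<close>
  let ?p = "Inf ((\<lambda>t. (U r - U t) / (r - t)) ` ({r<..} \<inter> {0..}))"
  have "U r + ?p * (s - r) \<le> U s" if "0 \<le> s" for s
    by (rule convex_le_Inf_differential[OF assms(1)]) (use that assms(2) in auto)
  then show "(?p, U r - ?p * r) \<in> affine_minorants U"
    by (auto simp: affine_minorants_def algebra_simps)
qed

lemma convex_on_star_shaped:
  fixes U :: "real \<Rightarrow> real"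
  assumes "convex_on {0..} U" "U 0 = 0" "0 < r" "r \<le> s"
  shows "U r / r \<le> U s / s"
proof -
  have "U ((1 - r / s) *\<^sub>R 0 + (r / s) *\<^sub>R s) \<le> (1 - r / s) * U 0 + r / s * U s"
    using assms by (intro convex_onD[OF assms(1)]) auto
  then show ?thesis using assms by (simp add: field_simps)
qed

text \<open>For \<open>r > 0\<close> a supporting line touches the graph at \<open>r\<close>. At 0
  there may be none; there, continuity supplies a line that starts at a value between
  \<open>c\<close> and 0 and has a sufficiently small slope.\<close>

lemma affine_minorant_close:
  assumes U: "continuous_on {0..} U" "convex_on {0..} U" "U 0 = 0" and "0 \<le> r" "c < U r"
  obtains a b where "(a, b) \<in> affine_minorants U" "c < a * r + b"
proof (cases "r = 0")
  case False
  then obtain p where "(p, U r - p * r) \<in> affine_minorants U"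
    using convex_on_subgradient[OF U(2), of r] assms(4) by auto
  with that[of p "U r - p * r"] assms(5) show ?thesis by simp
next
  case True
  define c' where "c' = c / 2"
  have c': "c' < 0" "c < c'" using assms True by (auto simp: c'_def)
  obtain d where d: "d > 0" "\<And>s. 0 \<le> s \<Longrightarrow> s < d \<Longrightarrow> dist (U s) (U 0) < - c'"
    using U(1)[unfolded continuous_on_iff, rule_format, of 0 "- c'"] c' by (auto simp: dist_real_def)
  define e where "e = d / 2"
  have e: "e > 0" "\<And>s. 0 \<le> s \<Longrightarrow> s \<le> e \<Longrightarrow> c' \<le> U s"
  proof -
    show "e > 0" using d by (simp add: e_def)
    show "c' \<le> U s" if "0 \<le> s" "s \<le> e" for s
      using d(2)[of s] that d(1) U(3) by (auto simp: e_def dist_real_def)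
  qed
  \<comment> \<open>On \<open>[0, e]\<close> a slope \<open>\<le> 0\<close> keeps the line below
    \<open>c'\<close>. Beyond \<open>e\<close> the line through the origin with slope
    \<open>U e / e\<close> is already below \<open>U\<close>, because the slopes of the chords from
    the origin increase.\<close>
  define a where "a = min 0 (U e / e)"
  have "a * s + c' \<le> U s" if "0 \<le> s" for s
  proof (cases "s \<le> e")
    case True
    then show ?thesis using e(2)[OF that True] that mult_nonpos_nonneg[of a s] by (simp add: a_def)
  next
    case False
    have "a * s \<le> U e / e * s" using that by (intro mult_right_mono) (auto simp: a_def)
    also have "\<dots> \<le> U s / s * s"
      using that False e by (intro mult_right_mono convex_on_star_shaped[OF U(2,3)]) auto
    finally show ?thesis using False e c' by simp
  qed
  then show ?thesis using that[of a c'] c' True by (auto simp: affine_minorants_def)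
qed

text \<open>A supporting line at \<open>r\<close> lies below \<open>U 0 = 0\<close> at the origin,
  so its intercept \<open>U r - p * r\<close> is at most 0.\<close>

lemma affine_minorant_steep:
  assumes "convex_on {0..} U" "U 0 = 0" "0 < r" "c < U r / r"
  obtains a b where "(a, b) \<in> affine_minorants U" "c < a"
proof -
  obtain p where p: "(p, U r - p * r) \<in> affine_minorants U"
    using convex_on_subgradient[OF assms(1,3)] .
  from affine_minorantsD[OF this, of 0] assms have "U r / r \<le> p"
    by (simp add: field_simps)
  with that[OF p] assms show ?thesis by simp
qed

text \<open>Lines with rational coefficients suffice: lowering slope and intercept keeps a line
  below \<open>U\<close> on the half-line, and a small enough lowering preserves strict
  inequalities.\<close>

lemma countable_affine_minorants:
  assumes U: "continuous_on {0..} U" "convex_on {0..} U" "U 0 = 0"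
  obtains l :: "nat \<Rightarrow> real \<times> real"
  where "\<And>n. l n \<in> affine_minorants U"
    and "\<And>r c. 0 \<le> r \<Longrightarrow> c < U r \<Longrightarrow> \<exists>n. c < fst (l n) * r + snd (l n)"
    and "\<And>a b c. (a, b) \<in> affine_minorants U \<Longrightarrow> c < a \<Longrightarrow> \<exists>n. c < fst (l n)"
proof -
  define Q where "Q = affine_minorants U \<inter> (\<rat> \<times> \<rat>)"
  have lower: "(a', b') \<in> affine_minorants U"
    if "(a, b) \<in> affine_minorants U" "a' \<le> a" "b' \<le> b" for a b a' b'
    unfolding affine_minorants_def
  proof clarify
    fix s :: real assume "0 \<le> s"
    then have "a' * s + b' \<le> a * s + b" using that by (intro add_mono mult_right_mono) auto
    also have "\<dots> \<le> U s" using affine_minorantsD[OF that(1) \<open>0 \<le> s\<close>] .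
    finally show "a' * s + b' \<le> U s" .
  qed
  have close: "\<exists>q\<in>Q. c < fst q * r + snd q" if r: "0 \<le> r" "c < U r" for r c
  proof -
    obtain a b where ab: "(a, b) \<in> affine_minorants U" "c < a * r + b"
      using affine_minorant_close[OF U r] .
    \<comment> \<open>Lowering both coefficients by \<open>d\<close> lowers the value at
      \<open>r\<close> by \<open>d * (r + 1)\<close>, exactly down to \<open>c\<close>; any smaller
      lowering stays above \<open>c\<close>.\<close>
    define d where "d = (a * r + b - c) / (r + 1)"
    have d: "d > 0" using ab r by (simp add: d_def)
    obtain a' where a': "a' \<in> \<rat>" "a - d < a'" "a' < a" using Rats_dense_in_real[of "a - d" a] d by auto
    obtain b' where b': "b' \<in> \<rat>" "b - d < b'" "b' < b" using Rats_dense_in_real[of "b - d" b] d by auto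
    have "d * (r + 1) = a * r + b - c" using r by (simp add: d_def)
    then have "c = (a - d) * r + (b - d)" by (simp add: algebra_simps)
    also have "\<dots> < a' * r + b'"
      using a' b' r by (intro add_le_less_mono mult_right_mono) auto
    finally show ?thesis
      using a' b' lower[OF ab(1), of a' b'] by (intro bexI[of _ "(a', b')"]) (auto simp: Q_def)
  qed
  have steep: "\<exists>q\<in>Q. c < fst q" if ab: "(a, b) \<in> affine_minorants U" "c < a" for a b c
  proof -
    obtain a' where a': "a' \<in> \<rat>" "c < a'" "a' < a" using Rats_dense_in_real[OF ab(2)] by auto
    obtain b' where b': "b' \<in> \<rat>" "b' < b" using Rats_dense_in_real[of "b - 1" b] by auto
    show ?thesis
      using a' b' lower[OF ab(1), of a' b'] by (intro bexI[of _ "(a', b')"]) (auto simp: Q_def)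
  qed
  have "countable Q" unfolding Q_def by (intro countable_Int2 countable_SIGMA countable_rat)
  moreover have "Q \<noteq> {}" using close[of 0 "-1"] U by auto
  ultimately have l: "range (from_nat_into Q) = Q" by (rule range_from_nat_into[rotated])
  have ex: "\<exists>n. q = from_nat_into Q n" if "q \<in> Q" for q using l that by auto
  show ?thesis
  proof (rule that[of "from_nat_into Q"])
    show "from_nat_into Q n \<in> affine_minorants U" for n using l by (auto simp: Q_def)
    show "\<exists>n. c < fst (from_nat_into Q n) * r + snd (from_nat_into Q n)"
      if "0 \<le> r" "c < U r" for r c using close[OF that] ex by metis
    show "\<exists>n. c < fst (from_nat_into Q n)"
      if "(a, b) \<in> affine_minorants U" "c < a" for a b c using steep[OF that] ex by metis
  qed
qed

text \<open>Since \<open>U r / r\<close> is monotone, its limit is its supremum over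
  \<open>r > 0\<close>. Dividing \<open>a * r + b \<le> U r\<close> by \<open>r\<close> bounds every
  slope by this limit, and supporting lines at suitable points come arbitrarily close to it or
  exceed any given bound below it.\<close>

lemma slope_at_infinity_minorants:
  assumes U: "convex_on {0..} U" "U 0 = 0"
  shows slope_at_infinity_upper: "(a, b) \<in> affine_minorants U \<Longrightarrow> ereal a \<le> slope_at_infinity U"
    and slope_at_infinity_approx: "ereal c < slope_at_infinity U \<Longrightarrow>
      \<exists>a b. (a, b) \<in> affine_minorants U \<and> c < a"
    and slope_at_infinity_neq_MInf: "slope_at_infinity U \<noteq> -\<infinity>"
proof -
  define L where "L = (SUP r\<in>{0<..}. ereal (U r / r))"
  have "((\<lambda>r. ereal (U r / r)) \<longlongrightarrow> L) at_top"
  proof (rule order_tendstoI)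
    fix y assume "y < L"
    then obtain r where r: "0 < r" "y < ereal (U r / r)" by (auto simp: L_def less_SUP_iff)
    have *: "y < ereal (U s / s)" if "r \<le> s" for s
      using r(2) convex_on_star_shaped[OF U r(1) that] by (metis ereal_less_eq(3) less_le_trans)
    show "eventually (\<lambda>s. y < ereal (U s / s)) at_top"
      using eventually_ge_at_top[of r] by eventually_elim (rule *)
  next
    fix y assume "L < y"
    have *: "ereal (U s / s) < y" if "0 < s" for s
    proof -
      have "ereal (U s / s) \<le> L" unfolding L_def by (rule SUP_upper) (use that in simp)
      also note \<open>L < y\<close>
      finally show ?thesis .
    qed
    show "eventually (\<lambda>s. ereal (U s / s) < y) at_top"
      using eventually_gt_at_top[of 0] by eventually_elim (rule *)
  qed
  then have SL: "slope_at_infinity U = L"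
    unfolding slope_at_infinity_def by (intro tendsto_Lim) auto
  note lim = \<open>((\<lambda>r. ereal (U r / r)) \<longlongrightarrow> L) at_top\<close>
  have upper: "ereal a \<le> slope_at_infinity U" if ab: "(a, b) \<in> affine_minorants U" for a b
    unfolding SL
  proof (rule tendsto_le[OF _ lim])
    have "((\<lambda>r. a + b / r) \<longlongrightarrow> a + 0) at_top"
      by (intro tendsto_add tendsto_const tendsto_divide_0[OF tendsto_const]
          filterlim_at_top_imp_at_infinity filterlim_ident)
    then show "((\<lambda>r. ereal (a + b / r)) \<longlongrightarrow> ereal a) at_top" by simp
    have *: "ereal (a + b / r) \<le> ereal (U r / r)" if "0 < r" for r
    proof -
      have "a + b / r = (a * r + b) / r" using that by (simp add: field_simps)
      also have "\<dots> \<le> U r / r" using that affine_minorantsD[OF ab, of r] by (intro divide_right_mono) auto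
      finally show ?thesis by simp
    qed
    show "eventually (\<lambda>r. ereal (a + b / r) \<le> ereal (U r / r)) at_top"
      using eventually_gt_at_top[of 0] by eventually_elim (rule *)
  qed simp
  then show "(a, b) \<in> affine_minorants U \<Longrightarrow> ereal a \<le> slope_at_infinity U" .
  obtain p where "(p, U 1 - p * 1) \<in> affine_minorants U"
    using convex_on_subgradient[OF U(1), of 1] by auto
  from upper[OF this] show "slope_at_infinity U \<noteq> -\<infinity>" by auto
  show "\<exists>a b. (a, b) \<in> affine_minorants U \<and> c < a" if c: "ereal c < slope_at_infinity U"
  proof -
    obtain r where "0 < r" "c < U r / r" using c by (auto simp: SL L_def less_SUP_iff)
    then show ?thesis using affine_minorant_steep[OF U] by metis
  qed
qed

section \<open>Approximation in mean by continuous functions\<close>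

lemma integrable_borel_bounded:
  fixes h :: "'a::topological_space \<Rightarrow> real"
  assumes "finite_measure M" "sets M = sets borel" "h \<in> borel_measurable borel" "\<And>x. \<bar>h x\<bar> \<le> B"
  shows "integrable M h"
proof -
  interpret finite_measure M by fact
  show ?thesis
    using assms by (intro integrable_const_bound[of _ B]) (auto cong: measurable_cong_sets)
qed

lemma integrable_continuous_compact:
  fixes h :: "'a::topological_space \<Rightarrow> real"
  assumes "compact (UNIV :: 'a set)" "finite_measure M" "sets M = sets borel" "continuous_on UNIV h"
  shows "integrable M h"
proof -
  have "bounded (range h)" by (intro compact_imp_bounded compact_continuous_image assms)
  then obtain B where "\<And>x. \<bar>h x\<bar> \<le> B" by (auto simp: bounded_iff)
  with assms show ?thesis
    by (intro integrable_borel_bounded[of M h B] borel_measurable_continuous_onI) auto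
qed

lemma closed_indicator_limit:
  fixes A :: "'a::metric_space set"
  assumes "closed A" "A \<noteq> {}"
  shows "(\<lambda>n. max 0 (1 - real n * infdist x A)) \<longlonglongrightarrow> indicat_real A x"
proof (cases "x \<in> A")
  case True
  then show ?thesis by simp
next
  case False
  then have d: "infdist x A > 0" using assms infdist_pos_not_in_closed by blast
  obtain m :: nat where m: "1 / infdist x A < real m" using reals_Archimedean2 by blast
  have "max 0 (1 - real n * infdist x A) = 0" if "m \<le> n" for n
  proof -
    have "1 < real m * infdist x A" using m d by (simp add: field_simps)
    also have "\<dots> \<le> real n * infdist x A" using that d by (intro mult_right_mono) auto
    finally show ?thesis by simp
  qed
  then have "eventually (\<lambda>n. max 0 (1 - real n * infdist x A) = indicat_real A x) sequentially"
    using False by (auto simp: eventually_sequentially)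
  then show ?thesis by (rule tendsto_eventually)
qed

text \<open>Closed sets are reached through the distance function; they are stable under
  intersection and generate the Borel sets, so complements and countable disjoint unions give the
  rest. The finite family \<open>\<M>\<close> is there so that one \<open>g\<close> serves several
  measures.\<close>

lemma borel_indicator_continuous_approx:
  fixes \<M> :: "'a::metric_space measure set"
  assumes fin: "finite \<M>" and \<M>: "\<And>M. M \<in> \<M> \<Longrightarrow> finite_measure M" "\<And>M. M \<in> \<M> \<Longrightarrow> sets M = sets borel"
    and A: "A \<in> sets borel"
  shows "\<forall>e>0. \<exists>g. continuous_on UNIV g \<and> (\<forall>x. 0 \<le> g x \<and> g x \<le> 1) \<and>
    (\<forall>M\<in>\<M>. (\<integral>x. \<bar>indicat_real A x - g x\<bar> \<partial>M) < e)"
proof -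
  have S: "sigma_sets UNIV (Collect closed) = (sets borel :: 'a set set)"
    by (subst borel_eq_closed) simp
  have int: "integrable M (\<lambda>x. \<bar>indicat_real B x - g x\<bar>)"
    if "M \<in> \<M>" "B \<in> sets borel" "continuous_on UNIV g" "\<forall>x. 0 \<le> g x \<and> g x \<le> 1" for M B g
  proof (rule integrable_borel_bounded[of _ _ 1])
    have [measurable]: "g \<in> borel_measurable borel" using that(3) by (rule borel_measurable_continuous_onI)
    have [measurable]: "B \<in> sets borel" by fact
    show "(\<lambda>x. \<bar>indicat_real B x - g x\<bar>) \<in> borel_measurable borel" by measurable
    show "\<bar>\<bar>indicat_real B x - g x\<bar>\<bar> \<le> 1" for x using that(4)[rule_format, of x] by (auto split: split_indicator)
  qed (use that \<M> in auto)
  \<comment> \<open>Dominated convergence with bound 1 turns a pointwise limit into closeness in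
    mean; finiteness of \<open>\<M>\<close> makes it hold eventually for all measures
    together.\<close>
  have L1: "eventually (\<lambda>n. \<forall>M\<in>\<M>. (\<integral>x. \<bar>indicat_real B x - h n x\<bar> \<partial>M) < e) sequentially"
    if B: "B \<in> sets borel" and h: "\<And>n::nat. h n \<in> borel_measurable borel" "\<And>n x. 0 \<le> h n x \<and> h n x \<le> 1"
      and lim: "\<And>x. (\<lambda>n. h n x) \<longlonglongrightarrow> indicat_real B x" and e: "0 < e" for B h e
  proof (rule eventually_ball_finite[OF fin], rule ballI)
    fix M assume M: "M \<in> \<M>"
    note [measurable] = h(1) B
    note [measurable_cong] = \<M>(2)[OF M]
    interpret finite_measure M using \<M>(1)[OF M] .
    have "(\<lambda>n. \<integral>x. \<bar>indicat_real B x - h n x\<bar> \<partial>M) \<longlonglongrightarrow> (\<integral>x. \<bar>0\<bar> \<partial>M)"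
    proof (rule integral_dominated_convergence[where w = "\<lambda>_. 1"])
      show "AE x in M. (\<lambda>n. \<bar>indicat_real B x - h n x\<bar>) \<longlonglongrightarrow> \<bar>0\<bar>"
      proof (rule AE_I2)
        fix x
        have "(\<lambda>n. \<bar>indicat_real B x - h n x\<bar>) \<longlonglongrightarrow> \<bar>indicat_real B x - indicat_real B x\<bar>"
          by (intro tendsto_intros lim)
        then show "(\<lambda>n. \<bar>indicat_real B x - h n x\<bar>) \<longlonglongrightarrow> \<bar>0\<bar>" by simp
      qed
      show "AE x in M. norm \<bar>indicat_real B x - h n x\<bar> \<le> 1" for n
        using h(2)[of n] by (intro AE_I2) (auto split: split_indicator)
    qed simp_all
    then have "(\<lambda>n. \<integral>x. \<bar>indicat_real B x - h n x\<bar> \<partial>M) \<longlonglongrightarrow> 0" by simp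
    then show "eventually (\<lambda>n. (\<integral>x. \<bar>indicat_real B x - h n x\<bar> \<partial>M) < e) sequentially"
      using e by (rule order_tendstoD)
  qed
  have stable: "Int_stable (Collect closed :: 'a set set)" by (auto simp: Int_stable_def)
  have "Collect closed \<subseteq> Pow (UNIV :: 'a set)" by simp
  moreover have "A \<in> sigma_sets UNIV (Collect closed)" using A S by simp
  ultimately show ?thesis
  proof (induction rule: sigma_sets_induct_disjoint[OF stable, consumes 2, case_names basic empty compl union])
    case (basic A)
    show ?case
    proof (intro allI impI)
      fix e :: real assume e: "0 < e"
      show "\<exists>g. continuous_on UNIV g \<and> (\<forall>x. 0 \<le> g x \<and> g x \<le> 1) \<and>
        (\<forall>M\<in>\<M>. (\<integral>x. \<bar>indicat_real A x - g x\<bar> \<partial>M) < e)"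
      proof (cases "A = {}")
        case True
        then show ?thesis using e by (intro exI[of _ "\<lambda>_. 0"]) auto
      next
        case False
        let ?h = "\<lambda>n x. max 0 (1 - real n * infdist x A)"
        have c: "continuous_on UNIV (?h n)" for n by (intro continuous_intros)
        have "eventually (\<lambda>n. \<forall>M\<in>\<M>. (\<integral>x. \<bar>indicat_real A x - ?h n x\<bar> \<partial>M) < e) sequentially"
          using basic False e
          by (intro L1 closed_indicator_limit borel_measurable_continuous_onI c) (auto simp: infdist_nonneg)
        then obtain n where "\<forall>M\<in>\<M>. (\<integral>x. \<bar>indicat_real A x - ?h n x\<bar> \<partial>M) < e"
          by (auto simp: eventually_sequentially)
        then show ?thesis using c[of n] by (intro exI[of _ "?h n"]) (auto simp: infdist_nonneg)
      qed
    qed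
  next
    case empty
    show ?case by (auto intro: exI[of _ "\<lambda>_. 0"])
  next
    case (compl A)
    show ?case
    proof (intro allI impI)
      fix e :: real assume "0 < e"
      with compl obtain g where g: "continuous_on UNIV g" "\<forall>x. 0 \<le> g x \<and> g x \<le> 1"
        "\<forall>M\<in>\<M>. (\<integral>x. \<bar>indicat_real A x - g x\<bar> \<partial>M) < e" by blast
      have eq: "\<bar>indicat_real (UNIV - A) x - (1 - g x)\<bar> = \<bar>indicat_real A x - g x\<bar>" for x
        by (auto split: split_indicator)
      have "continuous_on UNIV (\<lambda>x. 1 - g x)" using g(1) by (intro continuous_intros)
      moreover have "\<forall>M\<in>\<M>. (\<integral>x. \<bar>indicat_real (UNIV - A) x - (1 - g x)\<bar> \<partial>M) < e"
        unfolding eq by (rule g(3))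
      moreover have "\<forall>x. 0 \<le> 1 - g x \<and> 1 - g x \<le> 1" using g(2) by simp
      ultimately show "\<exists>g. continuous_on UNIV g \<and> (\<forall>x. 0 \<le> g x \<and> g x \<le> 1) \<and>
        (\<forall>M\<in>\<M>. (\<integral>x. \<bar>indicat_real (UNIV - A) x - g x\<bar> \<partial>M) < e)"
        by blast
    qed
  next
    case (union A)
    have A: "A i \<in> sets borel" for i using union(2) S by auto
    have UA: "(\<Union>i. A i) \<in> sets borel" "(\<Union>i<n. A i) \<in> sets borel" for n using A by auto
    show ?case
    proof (intro allI impI)
      fix e :: real assume e: "0 < e"
      let ?h = "\<lambda>n x. indicat_real (\<Union>i<n. A i) x"
      have "eventually (\<lambda>n. \<forall>M\<in>\<M>. (\<integral>x. \<bar>indicat_real (\<Union>i. A i) x - ?h n x\<bar> \<partial>M) < e / 2) sequentially"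
        using e UA by (intro L1 LIMSEQ_indicator_UN borel_measurable_indicator) (auto split: split_indicator)
      then obtain n where n: "\<forall>M\<in>\<M>. (\<integral>x. \<bar>indicat_real (\<Union>i. A i) x - ?h n x\<bar> \<partial>M) < e / 2"
        by (auto simp: eventually_sequentially)
      \<comment> \<open>\<open>n\<close> errors of size \<open>d\<close> add up to at most
        \<open>e / 2\<close>, and the other half of \<open>e\<close> covers cutting the union after
        \<open>n\<close> sets. The \<open>+ 1\<close> takes care of \<open>n = 0\<close>.\<close>
      define d where "d = e / (2 * (real n + 1))"
      have "d > 0" using e by (simp add: d_def)
      with union.IH have "\<forall>i. \<exists>g. continuous_on UNIV g \<and> (\<forall>x. 0 \<le> g x \<and> g x \<le> 1) \<and>
        (\<forall>M\<in>\<M>. (\<integral>x. \<bar>indicat_real (A i) x - g x\<bar> \<partial>M) < d)" by blast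
      then obtain g where g: "\<And>i. continuous_on UNIV (g i)" "\<And>i. \<forall>x. 0 \<le> g i x \<and> g i x \<le> 1"
        "\<And>i M. M \<in> \<M> \<Longrightarrow> (\<integral>x. \<bar>indicat_real (A i) x - g i x\<bar> \<partial>M) < d" by metis
      \<comment> \<open>Capping at 1 keeps the values in [0,1]. The indicator of the finite union is
        the capped sum of the indicators, and capping does not increase distances, so the separate
        errors simply add up.\<close>
      define G where "G x = min 1 (\<Sum>i<n. g i x)" for x
      have G: "continuous_on UNIV G" "\<forall>x. 0 \<le> G x \<and> G x \<le> 1"
      proof -
        show "continuous_on UNIV G" unfolding G_def by (intro continuous_intros g(1))
        have "0 \<le> (\<Sum>i<n. g i x)" for x using g(2) by (intro sum_nonneg) blast
        then show "\<forall>x. 0 \<le> G x \<and> G x \<le> 1" by (simp add: G_def)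
      qed
      have bd: "\<bar>?h n x - G x\<bar> \<le> (\<Sum>i<n. \<bar>indicat_real (A i) x - g i x\<bar>)" for x
      proof -
        have "?h n x = min 1 (\<Sum>i<n. indicat_real (A i) x)"
        proof (cases "x \<in> (\<Union>i<n. A i)")
          case True
          then obtain i where i: "i < n" "x \<in> A i" by auto
          have "indicat_real (A i) x \<le> (\<Sum>i<n. indicat_real (A i) x)"
            using i by (intro member_le_sum) auto
          with True i show ?thesis by simp
        next
          case False
          then have "(\<Sum>i<n. indicat_real (A i) x) = 0" by (intro sum.neutral) auto
          with False show ?thesis by simp
        qed
        then have "\<bar>?h n x - G x\<bar> \<le> \<bar>(\<Sum>i<n. indicat_real (A i) x) - (\<Sum>i<n. g i x)\<bar>"
          by (simp add: G_def)
        also have "\<dots> = \<bar>\<Sum>i<n. indicat_real (A i) x - g i x\<bar>" by (simp add: sum_subtractf)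
        also have "\<dots> \<le> (\<Sum>i<n. \<bar>indicat_real (A i) x - g i x\<bar>)" by (rule sum_abs)
        finally show ?thesis .
      qed
      have "(\<integral>x. \<bar>indicat_real (\<Union>i. A i) x - G x\<bar> \<partial>M) < e" if M: "M \<in> \<M>" for M
      proof -
        note I = int[OF M A g(1,2)]
        have cs: "(\<lambda>x. \<bar>indicat_real (\<Union>i. A i) x - ?h n x\<bar>) \<in> borel_measurable borel" using UA by measurable
        have I2: "integrable M (\<lambda>x. \<bar>indicat_real (\<Union>i. A i) x - ?h n x\<bar>)"
          by (rule integrable_borel_bounded[OF \<M>[OF M] cs, of 1]) (auto split: split_indicator)
        have "(\<integral>x. \<bar>indicat_real (\<Union>i. A i) x - G x\<bar> \<partial>M) \<le>
          (\<integral>x. \<bar>indicat_real (\<Union>i. A i) x - ?h n x\<bar> + (\<Sum>i<n. \<bar>indicat_real (A i) x - g i x\<bar>) \<partial>M)"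
        proof (rule integral_mono)
          show "\<bar>indicat_real (\<Union>i. A i) x - G x\<bar> \<le>
            \<bar>indicat_real (\<Union>i. A i) x - ?h n x\<bar> + (\<Sum>i<n. \<bar>indicat_real (A i) x - g i x\<bar>)" for x
            using bd[of x] by linarith
        qed (use int[OF M UA(1) G] I I2 in auto)
        also have "\<dots> = (\<integral>x. \<bar>indicat_real (\<Union>i. A i) x - ?h n x\<bar> \<partial>M) +
          (\<Sum>i<n. \<integral>x. \<bar>indicat_real (A i) x - g i x\<bar> \<partial>M)"
          using I I2 by simp
        also have "\<dots> < e / 2 + (\<Sum>i<n. d)"
          using n M g(3)[OF M] by (intro add_less_le_mono sum_mono) (auto intro: less_imp_le)
        also have "(\<Sum>i<n. d) \<le> e / 2" using e by (simp add: d_def field_simps)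
        finally show ?thesis by simp
      qed
      then show "\<exists>g. continuous_on UNIV g \<and> (\<forall>x. 0 \<le> g x \<and> g x \<le> 1) \<and>
        (\<forall>M\<in>\<M>. (\<integral>x. \<bar>indicat_real (\<Union>i. A i) x - g x\<bar> \<partial>M) < e)" using G by blast
    qed
  qed
qed

section \<open>Families of affine minorants and their continuous approximation\<close>

lemma affine_minorants_convex:
  assumes "(a, b) \<in> affine_minorants U" "(a', b') \<in> affine_minorants U" "0 \<le> t" "t \<le> 1"
  shows "(t * a + (1 - t) * a', t * b + (1 - t) * b') \<in> affine_minorants U"
  unfolding affine_minorants_def
proof clarify
  fix s :: real assume s: "0 \<le> s"
  have "(t * a + (1 - t) * a') * s + (t * b + (1 - t) * b') = t * (a * s + b) + (1 - t) * (a' * s + b')"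
    by (simp add: algebra_simps)
  also have "\<dots> \<le> t * U s + (1 - t) * U s"
    using assms s by (intro add_mono mult_left_mono affine_minorantsD) auto
  also have "\<dots> = U s" by (simp add: algebra_simps)
  finally show "(t * a + (1 - t) * a') * s + (t * b + (1 - t) * b') \<le> U s" .
qed

definition continuous_minorant :: "(real \<Rightarrow> real) \<Rightarrow> ('a::topological_space \<Rightarrow> real) \<Rightarrow> ('a \<Rightarrow> real) \<Rightarrow> bool" where
  "continuous_minorant U \<alpha> \<beta> \<longleftrightarrow> continuous_on UNIV \<alpha> \<and> continuous_on UNIV \<beta> \<and>
     (\<forall>x. (\<alpha> x, \<beta> x) \<in> affine_minorants U)"

text \<open>Among bounded Borel pairs, the closure of the continuous families of minorants: in mean
  for \<mu> in the slope and for \<nu> in the intercept, since the lower bound to be approximated is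
  \<integral>\<alpha> d\<mu> + \<integral>\<beta> d\<nu>.\<close>

definition approximable_minorant ::
  "(real \<Rightarrow> real) \<Rightarrow> 'a::topological_space measure \<Rightarrow> 'a measure \<Rightarrow> ('a \<Rightarrow> real) \<Rightarrow> ('a \<Rightarrow> real) \<Rightarrow> bool" where
  "approximable_minorant U \<mu> \<nu> \<alpha> \<beta> \<longleftrightarrow>
     \<alpha> \<in> borel_measurable borel \<and> \<beta> \<in> borel_measurable borel \<and>
     (\<exists>B. \<forall>x. \<bar>\<alpha> x\<bar> \<le> B \<and> \<bar>\<beta> x\<bar> \<le> B) \<and>
     (\<forall>e>0. \<exists>\<alpha>' \<beta>'. continuous_minorant U \<alpha>' \<beta>' \<and>
        (\<integral>x. \<bar>\<alpha> x - \<alpha>' x\<bar> \<partial>\<mu>) < e \<and> (\<integral>x. \<bar>\<beta> x - \<beta>' x\<bar> \<partial>\<nu>) < e)"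

lemma approximable_minorant_const:
  assumes "(a, b) \<in> affine_minorants U"
  shows "approximable_minorant U \<mu> \<nu> (\<lambda>_. a) (\<lambda>_. b)"
  unfolding approximable_minorant_def
proof (intro conjI allI impI)
  show "\<exists>B. \<forall>x::'a. \<bar>a\<bar> \<le> B \<and> \<bar>b\<bar> \<le> B" by (intro exI[of _ "max \<bar>a\<bar> \<bar>b\<bar>"]) auto
  fix e :: real assume "0 < e"
  with assms show "\<exists>\<alpha>' \<beta>'. continuous_minorant U \<alpha>' \<beta>' \<and>
    (\<integral>x. \<bar>a - \<alpha>' x\<bar> \<partial>\<mu>) < e \<and> (\<integral>x. \<bar>b - \<beta>' x\<bar> \<partial>\<nu>) < e"
    by (intro exI[of _ "\<lambda>_. a"] exI[of _ "\<lambda>_. b"]) (simp add: continuous_minorant_def)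
qed auto

locale compact_prob_pair =
  fixes \<mu> \<nu> :: "'a::metric_space measure"
  assumes compact_UNIV: "compact (UNIV :: 'a set)"
    and prob_\<mu>: "prob_space \<mu>" and prob_\<nu>: "prob_space \<nu>"
    and sets_\<mu>: "sets \<mu> = sets borel" and sets_\<nu>: "sets \<nu> = sets borel"
begin

sublocale \<mu>: prob_space \<mu> by (rule prob_\<mu>)
sublocale \<nu>: prob_space \<nu> by (rule prob_\<nu>)

lemmas [measurable_cong] = sets_\<mu> sets_\<nu>

lemma integrable_imp_borel:
  "integrable \<mu> (h :: 'a \<Rightarrow> real) \<Longrightarrow> h \<in> borel_measurable borel"
  "integrable \<nu> (h :: 'a \<Rightarrow> real) \<Longrightarrow> h \<in> borel_measurable borel"
  using measurable_cong_sets[OF sets_\<mu> refl, of "borel :: real measure"]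
    measurable_cong_sets[OF sets_\<nu> refl, of "borel :: real measure"]
  by (auto dest: borel_measurable_integrable)

lemma integrable_continuous:
  assumes "continuous_on UNIV (h :: 'a \<Rightarrow> real)"
  shows "integrable \<mu> h" "integrable \<nu> h"
  using integrable_continuous_compact[OF compact_UNIV _ _ assms] sets_\<mu> sets_\<nu>
    \<mu>.finite_measure_axioms \<nu>.finite_measure_axioms by auto

lemma integrable_bounded:
  assumes "(h :: 'a \<Rightarrow> real) \<in> borel_measurable borel" "\<And>x. \<bar>h x\<bar> \<le> B"
  shows "integrable \<mu> h" "integrable \<nu> h"
  using integrable_borel_bounded[OF _ _ assms] sets_\<mu> sets_\<nu>
    \<mu>.finite_measure_axioms \<nu>.finite_measure_axioms by auto

lemma continuous_bounded:
  assumes "continuous_on UNIV (h :: 'a \<Rightarrow> real)"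
  obtains B where "0 < B" "\<And>x. \<bar>h x\<bar> \<le> B"
proof -
  have "bounded (range h)" by (intro compact_imp_bounded compact_continuous_image assms compact_UNIV)
  then show ?thesis using that by (auto simp: bounded_pos)
qed

lemma continuous_borel:
  assumes "continuous_on UNIV (h :: 'a \<Rightarrow> real)"
  shows "h \<in> borel_measurable borel"
  using assms by (rule borel_measurable_continuous_onI)

text \<open>Three separate errors: replacing \<open>h1\<close> by \<open>k1\<close>, replacing
  \<open>h2\<close> by \<open>k2\<close>, and replacing the sharp switch on \<open>E\<close> by the
  weight \<open>g\<close>. The last one acts only on the gap \<open>k1 - k2\<close>, which is at
  most \<open>2 * C\<close> in absolute value.\<close>

lemma integral_switch_le:
  fixes h1 h2 k1 k2 g :: "'a \<Rightarrow> real"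
  assumes M: "M \<in> {\<mu>, \<nu>}" and E: "E \<in> sets borel"
    and h: "h1 \<in> borel_measurable borel" "h2 \<in> borel_measurable borel"
      "\<And>x. \<bar>h1 x\<bar> \<le> B" "\<And>x. \<bar>h2 x\<bar> \<le> B"
    and k: "continuous_on UNIV k1" "continuous_on UNIV k2" "\<And>x. \<bar>k1 x\<bar> \<le> C" "\<And>x. \<bar>k2 x\<bar> \<le> C"
    and g: "continuous_on UNIV g" "\<And>x. 0 \<le> g x \<and> g x \<le> 1"
  shows "(\<integral>x. \<bar>(if x \<in> E then h1 x else h2 x) - (g x * k1 x + (1 - g x) * k2 x)\<bar> \<partial>M)
    \<le> (\<integral>x. \<bar>h1 x - k1 x\<bar> \<partial>M) + (\<integral>x. \<bar>h2 x - k2 x\<bar> \<partial>M) + 2 * C * (\<integral>x. \<bar>indicator E x - g x\<bar> \<partial>M)"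
proof -
  note [measurable] = E h(1,2) k(1,2)[THEN continuous_borel] g(1)[THEN continuous_borel]
  have bdd: "integrable M f" if "f \<in> borel_measurable borel" "\<forall>x. \<bar>f x\<bar> \<le> D" for f :: "'a \<Rightarrow> real" and D
    using integrable_bounded[of f D] that M by auto
  have i1: "integrable M (\<lambda>x. \<bar>h1 x - k1 x\<bar>)"
  proof (rule bdd[of _ "B + C"])
    show "\<forall>x. \<bar>\<bar>h1 x - k1 x\<bar>\<bar> \<le> B + C"
    proof
      fix x show "\<bar>\<bar>h1 x - k1 x\<bar>\<bar> \<le> B + C" using h(3)[of x] k(3)[of x] by linarith
    qed
  qed measurable
  have i1': "integrable M (\<lambda>x. \<bar>h2 x - k2 x\<bar>)"
  proof (rule bdd[of _ "B + C"])
    show "\<forall>x. \<bar>\<bar>h2 x - k2 x\<bar>\<bar> \<le> B + C"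
    proof
      fix x show "\<bar>\<bar>h2 x - k2 x\<bar>\<bar> \<le> B + C" using h(4)[of x] k(4)[of x] by linarith
    qed
  qed measurable
  have i2: "integrable M (\<lambda>x. \<bar>indicat_real E x - g x\<bar>)"
  proof (rule bdd[of _ 1])
    show "\<forall>x. \<bar>\<bar>indicat_real E x - g x\<bar>\<bar> \<le> 1"
    proof
      fix x show "\<bar>\<bar>indicat_real E x - g x\<bar>\<bar> \<le> 1" using g(2)[of x] by (auto split: split_indicator)
    qed
  qed measurable
  have pw: "\<bar>(if x \<in> E then h1 x else h2 x) - (g x * k1 x + (1 - g x) * k2 x)\<bar>
      \<le> \<bar>h1 x - k1 x\<bar> + \<bar>h2 x - k2 x\<bar> + 2 * C * \<bar>indicator E x - g x\<bar>" for x
  proof -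
    let ?i = "indicat_real E x"
    have eq: "(if x \<in> E then h1 x else h2 x) - (g x * k1 x + (1 - g x) * k2 x)
      = ?i * (h1 x - k1 x) + (1 - ?i) * (h2 x - k2 x) + (k1 x - k2 x) * (?i - g x)"
      by (auto simp: algebra_simps split: split_indicator)
    have "\<bar>(if x \<in> E then h1 x else h2 x) - (g x * k1 x + (1 - g x) * k2 x)\<bar>
      \<le> \<bar>?i * (h1 x - k1 x)\<bar> + \<bar>(1 - ?i) * (h2 x - k2 x)\<bar> + \<bar>(k1 x - k2 x) * (?i - g x)\<bar>"
      unfolding eq by linarith
    also have "\<dots> \<le> \<bar>h1 x - k1 x\<bar> + \<bar>h2 x - k2 x\<bar> + 2 * C * \<bar>?i - g x\<bar>"
    proof (intro add_mono)
      have "\<bar>k1 x - k2 x\<bar> \<le> 2 * C" using k(3,4)[of x] by linarith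
      then show "\<bar>(k1 x - k2 x) * (?i - g x)\<bar> \<le> 2 * C * \<bar>?i - g x\<bar>"
        unfolding abs_mult by (rule mult_right_mono) simp
    qed (auto split: split_indicator)
    finally show ?thesis .
  qed
  have i3: "integrable M (\<lambda>x. \<bar>(if x \<in> E then h1 x else h2 x) - (g x * k1 x + (1 - g x) * k2 x)\<bar>)"
  proof (rule Bochner_Integration.integrable_bound)
    show "integrable M (\<lambda>x. \<bar>h1 x - k1 x\<bar> + \<bar>h2 x - k2 x\<bar> + 2 * C * \<bar>indicator E x - g x\<bar>)"
      using i1 i1' i2 by auto
    show "(\<lambda>x. \<bar>(if x \<in> E then h1 x else h2 x) - (g x * k1 x + (1 - g x) * k2 x)\<bar>) \<in> borel_measurable M"
    proof -
      have "sets M = sets borel" using M sets_\<mu> sets_\<nu> by auto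
      note [measurable_cong] = this
      show ?thesis by measurable
    qed
    show "AE x in M. norm \<bar>(if x \<in> E then h1 x else h2 x) - (g x * k1 x + (1 - g x) * k2 x)\<bar>
      \<le> norm (\<bar>h1 x - k1 x\<bar> + \<bar>h2 x - k2 x\<bar> + 2 * C * \<bar>indicator E x - g x\<bar>)"
      using pw by (intro AE_I2) (metis abs_ge_self abs_idempotent order_trans real_norm_def)
  qed
  have "(\<integral>x. \<bar>(if x \<in> E then h1 x else h2 x) - (g x * k1 x + (1 - g x) * k2 x)\<bar> \<partial>M)
    \<le> (\<integral>x. \<bar>h1 x - k1 x\<bar> + \<bar>h2 x - k2 x\<bar> + 2 * C * \<bar>indicator E x - g x\<bar> \<partial>M)"
    using i1 i1' i2 by (intro integral_mono i3 pw) auto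
  also have "\<dots> = (\<integral>x. \<bar>h1 x - k1 x\<bar> \<partial>M) + (\<integral>x. \<bar>h2 x - k2 x\<bar> \<partial>M) + 2 * C * (\<integral>x. \<bar>indicator E x - g x\<bar> \<partial>M)"
    using i1 i1' i2 by simp
  finally show ?thesis .
qed

lemma approximable_minorant_switch:
  assumes 1: "approximable_minorant U \<mu> \<nu> \<alpha>1 \<beta>1" and 2: "approximable_minorant U \<mu> \<nu> \<alpha>2 \<beta>2"
    and E: "E \<in> sets borel"
  shows "approximable_minorant U \<mu> \<nu> (\<lambda>x. if x \<in> E then \<alpha>1 x else \<alpha>2 x) (\<lambda>x. if x \<in> E then \<beta>1 x else \<beta>2 x)"
proof -
  have meas [measurable]: "\<alpha>1 \<in> borel_measurable borel" "\<alpha>2 \<in> borel_measurable borel"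
    "\<beta>1 \<in> borel_measurable borel" "\<beta>2 \<in> borel_measurable borel"
    using 1 2 by (auto simp: approximable_minorant_def)
  note [measurable] = E
  obtain B1 B2 where B12: "\<And>x. \<bar>\<alpha>1 x\<bar> \<le> B1 \<and> \<bar>\<beta>1 x\<bar> \<le> B1" "\<And>x. \<bar>\<alpha>2 x\<bar> \<le> B2 \<and> \<bar>\<beta>2 x\<bar> \<le> B2"
    using 1 2 unfolding approximable_minorant_def by metis
  define B where "B = max B1 B2"
  have B: "\<bar>\<alpha>1 x\<bar> \<le> B" "\<bar>\<beta>1 x\<bar> \<le> B" "\<bar>\<alpha>2 x\<bar> \<le> B" "\<bar>\<beta>2 x\<bar> \<le> B" for x
    using B12[of x] by (auto simp: B_def)
  show ?thesis
    unfolding approximable_minorant_def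
  proof (intro conjI allI impI)
    show "(\<lambda>x. if x \<in> E then \<alpha>1 x else \<alpha>2 x) \<in> borel_measurable borel"
      "(\<lambda>x. if x \<in> E then \<beta>1 x else \<beta>2 x) \<in> borel_measurable borel" by measurable
    show "\<exists>B. \<forall>x. \<bar>if x \<in> E then \<alpha>1 x else \<alpha>2 x\<bar> \<le> B \<and> \<bar>if x \<in> E then \<beta>1 x else \<beta>2 x\<bar> \<le> B"
      using B by (intro exI[of _ B]) auto
    fix e :: real assume e: "0 < e"
    then have e3: "0 < e / 3" by simp
    obtain a1 b1 where ab1: "continuous_minorant U a1 b1"
      "(\<integral>x. \<bar>\<alpha>1 x - a1 x\<bar> \<partial>\<mu>) < e / 3" "(\<integral>x. \<bar>\<beta>1 x - b1 x\<bar> \<partial>\<nu>) < e / 3"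
      using 1 e3 unfolding approximable_minorant_def by blast
    obtain a2 b2 where ab2: "continuous_minorant U a2 b2"
      "(\<integral>x. \<bar>\<alpha>2 x - a2 x\<bar> \<partial>\<mu>) < e / 3" "(\<integral>x. \<bar>\<beta>2 x - b2 x\<bar> \<partial>\<nu>) < e / 3"
      using 2 e3 unfolding approximable_minorant_def by blast
    have c: "continuous_on UNIV a1" "continuous_on UNIV a2" "continuous_on UNIV b1" "continuous_on UNIV b2"
      using ab1(1) ab2(1) by (auto simp: continuous_minorant_def)
    have "continuous_on UNIV (\<lambda>x. \<bar>a1 x\<bar> + \<bar>a2 x\<bar> + \<bar>b1 x\<bar> + \<bar>b2 x\<bar>)"
      using c by (intro continuous_intros)
    from continuous_bounded[OF this] obtain C where
      "0 < C" and C': "\<And>x. \<bar>\<bar>a1 x\<bar> + \<bar>a2 x\<bar> + \<bar>b1 x\<bar> + \<bar>b2 x\<bar>\<bar> \<le> C" by blast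
    have C: "\<bar>a1 x\<bar> \<le> C" "\<bar>a2 x\<bar> \<le> C" "\<bar>b1 x\<bar> \<le> C" "\<bar>b2 x\<bar> \<le> C" for x
      using C'[of x] by linarith+
    \<comment> \<open>The weight \<open>g\<close> is chosen last because its tolerance depends on
      the bound \<open>C\<close> of the continuous families; multiplied by \<open>2 * C\<close>,
      this tolerance becomes \<open>e / 3\<close>. The same \<open>g\<close> blends slopes and
      intercepts, which keeps the blend a minorant, so it has to work for both measures.\<close>
    have "0 < e / (6 * C)" using e \<open>0 < C\<close> by simp
    with borel_indicator_continuous_approx[of "{\<mu>, \<nu>}" E]
    obtain g where g: "continuous_on UNIV g" "\<forall>x. 0 \<le> g x \<and> g x \<le> 1"
      "\<forall>M\<in>{\<mu>, \<nu>}. (\<integral>x. \<bar>indicat_real E x - g x\<bar> \<partial>M) < e / (6 * C)"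
      using E sets_\<mu> sets_\<nu> \<mu>.finite_measure_axioms \<nu>.finite_measure_axioms by blast
    have g3: "2 * C * (\<integral>x. \<bar>indicat_real E x - g x\<bar> \<partial>M) < e / 3" if "M \<in> {\<mu>, \<nu>}" for M
    proof -
      have "2 * C * (\<integral>x. \<bar>indicat_real E x - g x\<bar> \<partial>M) < 2 * C * (e / (6 * C))"
        using g(3) that \<open>0 < C\<close> by (intro mult_strict_left_mono) auto
      then show ?thesis using \<open>0 < C\<close> by simp
    qed
    have g2: "0 \<le> g x \<and> g x \<le> 1" for x using g(2) by blast
    let ?a = "\<lambda>x. g x * a1 x + (1 - g x) * a2 x" and ?b = "\<lambda>x. g x * b1 x + (1 - g x) * b2 x"
    have "continuous_minorant U ?a ?b"
      unfolding continuous_minorant_def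
    proof (intro conjI allI)
      show "continuous_on UNIV ?a" "continuous_on UNIV ?b" by (intro continuous_intros c g(1))+
      show "(?a x, ?b x) \<in> affine_minorants U" for x
        using ab1(1) ab2(1) g2 by (intro affine_minorants_convex) (auto simp: continuous_minorant_def)
    qed
    moreover have "(\<integral>x. \<bar>(if x \<in> E then \<alpha>1 x else \<alpha>2 x) - ?a x\<bar> \<partial>\<mu>) < e"
      using integral_switch_le[of \<mu>, OF _ E meas(1,2) B(1,3) c(1,2) C(1,2) g(1) g2] ab1(2) ab2(2) g3[of \<mu>]
      by simp
    moreover have "(\<integral>x. \<bar>(if x \<in> E then \<beta>1 x else \<beta>2 x) - ?b x\<bar> \<partial>\<nu>) < e"
      using integral_switch_le[of \<nu>, OF _ E meas(3,4) B(2,4) c(3,4) C(3,4) g(1) g2] ab1(3) ab2(3) g3[of \<nu>]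
      by simp
    ultimately show "\<exists>\<alpha>' \<beta>'. continuous_minorant U \<alpha>' \<beta>' \<and>
        (\<integral>x. \<bar>(if x \<in> E then \<alpha>1 x else \<alpha>2 x) - \<alpha>' x\<bar> \<partial>\<mu>) < e \<and>
        (\<integral>x. \<bar>(if x \<in> E then \<beta>1 x else \<beta>2 x) - \<beta>' x\<bar> \<partial>\<nu>) < e"
      by blast
  qed
qed

text \<open>Integrating \<open>\<alpha>' x * f k x + \<beta>' x \<le> U (f k x)\<close> against
  \<nu> bounds the integral of \<open>U (f k x)\<close> below by a quantity with known limit: only
  the slope term depends on \<open>k\<close>, and the continuous \<alpha>' is an admissible test
  function.\<close>

lemma approximable_minorant_liminf:
  assumes app: "approximable_minorant U \<mu> \<nu> \<alpha> \<beta>" and U: "continuous_on {0..} U"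
    and f: "\<And>k. continuous_on UNIV (f k)" "\<And>k x. 0 \<le> f k x"
    and lim: "\<And>\<phi>. continuous_on UNIV \<phi> \<Longrightarrow> (\<lambda>k. \<integral>x. f k x * \<phi> x \<partial>\<nu>) \<longlonglongrightarrow> (\<integral>x. \<phi> x \<partial>\<mu>)"
    and c: "c < (\<integral>x. \<alpha> x \<partial>\<mu>) + (\<integral>x. \<beta> x \<partial>\<nu>)"
  shows "eventually (\<lambda>k. c < (\<integral>x. U (f k x) \<partial>\<nu>)) sequentially"
proof -
  \<comment> \<open>Half the gap: one error comes from the slopes, the other from the
    intercepts.\<close>
  define e where "e = ((\<integral>x. \<alpha> x \<partial>\<mu>) + (\<integral>x. \<beta> x \<partial>\<nu>) - c) / 2"
  have "0 < e" using c by (simp add: e_def)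
  with app obtain \<alpha>' \<beta>' where ab: "continuous_minorant U \<alpha>' \<beta>'"
    "(\<integral>x. \<bar>\<alpha> x - \<alpha>' x\<bar> \<partial>\<mu>) < e" "(\<integral>x. \<bar>\<beta> x - \<beta>' x\<bar> \<partial>\<nu>) < e"
    unfolding approximable_minorant_def by blast
  obtain B where B: "\<And>x. \<bar>\<alpha> x\<bar> \<le> B \<and> \<bar>\<beta> x\<bar> \<le> B" and m: "\<alpha> \<in> borel_measurable borel" "\<beta> \<in> borel_measurable borel"
    using app unfolding approximable_minorant_def by blast
  have cab: "continuous_on UNIV \<alpha>'" "continuous_on UNIV \<beta>'" and ab': "\<And>x. (\<alpha>' x, \<beta>' x) \<in> affine_minorants U"
    using ab(1) by (auto simp: continuous_minorant_def)
  have "\<bar>(\<integral>x. \<alpha> x \<partial>\<mu>) - (\<integral>x. \<alpha>' x \<partial>\<mu>)\<bar> < e"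
    using ab(2) integral_abs_bound[of \<mu> "\<lambda>x. \<alpha> x - \<alpha>' x"]
      integrable_bounded(1)[OF m(1), of B] B integrable_continuous(1)[OF cab(1)] by simp
  moreover have "\<bar>(\<integral>x. \<beta> x \<partial>\<nu>) - (\<integral>x. \<beta>' x \<partial>\<nu>)\<bar> < e"
    using ab(3) integral_abs_bound[of \<nu> "\<lambda>x. \<beta> x - \<beta>' x"]
      integrable_bounded(2)[OF m(2), of B] B integrable_continuous(2)[OF cab(2)] by simp
  ultimately have c': "c < (\<integral>x. \<alpha>' x \<partial>\<mu>) + (\<integral>x. \<beta>' x \<partial>\<nu>)" 
    unfolding e_def by (simp only: abs_less_iff) argo
  have "(\<lambda>k. (\<integral>x. f k x * \<alpha>' x \<partial>\<nu>) + (\<integral>x. \<beta>' x \<partial>\<nu>)) \<longlonglongrightarrow> (\<integral>x. \<alpha>' x \<partial>\<mu>) + (\<integral>x. \<beta>' x \<partial>\<nu>)"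
    by (intro tendsto_add lim cab tendsto_const)
  then have "eventually (\<lambda>k. c < (\<integral>x. f k x * \<alpha>' x \<partial>\<nu>) + (\<integral>x. \<beta>' x \<partial>\<nu>)) sequentially"
    using c' by (rule order_tendstoD)
  then show ?thesis
  proof eventually_elim
    case (elim k)
    have cf: "continuous_on UNIV (\<lambda>x. f k x * \<alpha>' x)" by (intro continuous_on_mult f cab)
    have cU: "continuous_on UNIV (\<lambda>x. U (f k x))"
      by (rule continuous_on_compose2[OF U f(1)]) (use f(2) in auto)
    have "(\<integral>x. f k x * \<alpha>' x \<partial>\<nu>) + (\<integral>x. \<beta>' x \<partial>\<nu>) = (\<integral>x. f k x * \<alpha>' x + \<beta>' x \<partial>\<nu>)"
      by (intro Bochner_Integration.integral_add[symmetric] integrable_continuous cf cab)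
    also have "\<dots> \<le> (\<integral>x. U (f k x) \<partial>\<nu>)"
    proof (rule integral_mono)
      show "f k x * \<alpha>' x + \<beta>' x \<le> U (f k x)" for x
        using affine_minorantsD[OF ab'[of x] f(2)] by (simp add: mult.commute)
      show "integrable \<nu> (\<lambda>x. f k x * \<alpha>' x + \<beta>' x)"
        by (intro Bochner_Integration.integrable_add integrable_continuous cf cab)
    qed (rule integrable_continuous[OF cU])
    finally show ?case using elim by simp
  qed
qed

end

section \<open>Smoothing by a partition of unity\<close>

text \<open>Normalised tent functions. An index is also the centre of its tent, so that on the piece
  \<open>i\<close> a test function \<phi> can be compared with its value
  \<open>\<phi> i\<close>.\<close>

lemma compact_partition_of_unity:
  assumes "compact (UNIV :: 'a::metric_space set)" "0 < e"
  obtains S :: "'a::metric_space set" and \<psi> :: "'a::metric_space \<Rightarrow> 'a \<Rightarrow> real"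
  where "finite S" "\<And>i. i \<in> S \<Longrightarrow> continuous_on UNIV (\<psi> i)" "\<And>i x. 0 \<le> \<psi> i x"
    "\<And>x. (\<Sum>i\<in>S. \<psi> i x) = 1" "\<And>i x. \<psi> i x \<noteq> 0 \<Longrightarrow> dist i x < e"
proof -
  have "UNIV \<subseteq> (\<Union>i. ball i e)" using assms(2) by auto
  from compactE_image[OF assms(1) _ this] obtain S :: "'a set"
    where S: "finite S" "UNIV \<subseteq> (\<Union>i\<in>S. ball i e)" by (metis open_ball)
  define h where "h i x = max 0 (e - dist i x)" for i x :: 'a
  have h0: "0 \<le> h i x" for i x by (simp add: h_def)
  have pos: "0 < (\<Sum>i\<in>S. h i x)" for x
  proof -
    obtain i where i: "i \<in> S" "dist i x < e" using S(2) by (metis UNIV_I UN_E mem_ball subsetD)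
    then have "0 < h i x" by (simp add: h_def)
    also have "\<dots> \<le> (\<Sum>i\<in>S. h i x)" using i S(1) h0 by (intro member_le_sum) auto
    finally show ?thesis .
  qed
  have hc: "continuous_on UNIV (h i)" for i unfolding h_def by (intro continuous_intros)
  show ?thesis
  proof (rule that[of S "\<lambda>i x. h i x / (\<Sum>j\<in>S. h j x)"])
    show "continuous_on UNIV (\<lambda>x. h i x / (\<Sum>j\<in>S. h j x))" for i
      using pos by (intro continuous_intros hc) (simp add: less_imp_neq[symmetric])
    show "0 \<le> h i x / (\<Sum>j\<in>S. h j x)" for i x using h0 pos[of x] by simp
    show "(\<Sum>i\<in>S. h i x / (\<Sum>j\<in>S. h j x)) = 1" for x
      using pos[of x] by (simp flip: sum_divide_distrib)
    show "dist i x < e" if "h i x / (\<Sum>j\<in>S. h j x) \<noteq> 0" for i x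
      using that by (auto simp: h_def max_def split: if_splits)
  qed (rule S)
qed

context compact_prob_pair
begin

text \<open>The open set where \<psi> is positive is \<nu>-null, so it misses the support of \<nu>
  and hence that of \<mu>: each of its points has a \<mu>-null neighbourhood. Compactness turns this
  local statement into a global one.\<close>

lemma integral_eq_0_msupport:
  assumes supp: "msupport \<mu> \<subseteq> msupport \<nu>"
    and \<psi>: "continuous_on UNIV (\<psi> :: 'a \<Rightarrow> real)" "\<And>x. 0 \<le> \<psi> x" "(\<integral>x. \<psi> x \<partial>\<nu>) = 0"
  shows "(\<integral>x. \<psi> x \<partial>\<mu>) = 0"
proof -
  have op: "open {x. 0 < \<psi> x}" by (intro open_Collect_less \<psi> continuous_on_const)
  have "AE x in \<nu>. \<psi> x = 0"
    using integral_nonneg_eq_0_iff_AE[OF integrable_continuous(2)[OF \<psi>(1)]] \<psi> by simp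
  then have "emeasure \<nu> {x \<in> space \<nu>. 0 < \<psi> x} = 0"
    by (intro emeasure_eq_0_AE) (auto elim: eventually_mono)
  moreover have "space \<nu> = UNIV" using sets_eq_imp_space_eq[OF sets_\<nu>] by simp
  ultimately have "emeasure \<nu> {x. 0 < \<psi> x} = 0" by simp
  then have ns: "x \<notin> msupport \<mu>" if "0 < \<psi> x" for x
    using supp op that by (force simp: msupport_def)
  \<comment> \<open>The open set itself need not be compact, so finite subcovers are taken on closed
    level sets, countably many of which exhaust it.\<close>
  have null: "{x. 1 / Suc n \<le> \<psi> x} \<in> null_sets \<mu>" for n
  proof -
    let ?K = "{x. 1 / Suc n \<le> \<psi> x}"
    have K: "closed ?K" by (intro closed_Collect_le \<psi> continuous_on_const)
    then have "compact ?K" using compact_Int_closed[OF compact_UNIV, of ?K] by simp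
    have "\<forall>x\<in>?K. \<exists>T. open T \<and> x \<in> T \<and> emeasure \<mu> T = 0"
    proof
      fix x assume "x \<in> ?K"
      then have "0 < \<psi> x" by (auto intro: less_le_trans[of _ "1 / Suc n"])
      from ns[OF this] show "\<exists>T. open T \<and> x \<in> T \<and> emeasure \<mu> T = 0"
        by (auto simp: msupport_def zero_less_iff_neq_zero)
    qed
    then obtain T where T: "\<And>x. x \<in> ?K \<Longrightarrow> open (T x) \<and> x \<in> T x \<and> emeasure \<mu> (T x) = 0" by metis
    have "?K \<subseteq> (\<Union>x\<in>?K. T x)" using T by blast
    from compactE_image[OF \<open>compact ?K\<close> _ this]
    obtain C where C: "C \<subseteq> ?K" "finite C" "?K \<subseteq> (\<Union>x\<in>C. T x)" using T by metis
    have "(\<Union>x\<in>C. T x) \<in> null_sets \<mu>"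
      using T C by (intro null_sets_UN' countable_finite) (auto simp: null_sets_def sets_\<mu>)
    then show ?thesis by (rule null_sets_subset) (use C K in \<open>auto simp: sets_\<mu>\<close>)
  qed
  have "AE x in \<mu>. \<forall>n. x \<notin> {x. 1 / Suc n \<le> \<psi> x}"
    unfolding AE_all_countable using null by (blast intro: AE_not_in)
  then have "AE x in \<mu>. \<psi> x = 0"
  proof eventually_elim
    case (elim x)
    show ?case
    proof (rule ccontr)
      assume "\<psi> x \<noteq> 0"
      then have "0 < \<psi> x" using \<psi>(2)[of x] by simp
      then obtain n where "1 / Suc n < \<psi> x" using nat_approx_posE by blast
      with elim show False by (auto simp: not_le dest: less_asym)
    qed
  qed
  then show ?thesis by (rule integral_eq_zero_AE)
qed

lemma integral_localized:
  assumes M: "M \<in> {\<mu>, \<nu>}" and \<psi>: "continuous_on UNIV (\<psi> :: 'a \<Rightarrow> real)" "\<And>x. 0 \<le> \<psi> x"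
    and \<phi>: "continuous_on UNIV (\<phi> :: 'a \<Rightarrow> real)" "\<And>x. \<psi> x \<noteq> 0 \<Longrightarrow> \<bar>\<phi> x - c\<bar> \<le> w"
  shows "\<bar>(\<integral>x. \<psi> x * \<phi> x \<partial>M) - c * (\<integral>x. \<psi> x \<partial>M)\<bar> \<le> w * (\<integral>x. \<psi> x \<partial>M)"
proof -
  have int: "integrable M h" if "continuous_on UNIV h" for h :: "'a \<Rightarrow> real"
    using integrable_continuous[OF that] M by auto
  have i1: "integrable M \<psi>" by (rule int[OF \<psi>(1)])
  have i2: "integrable M (\<lambda>x. \<psi> x * \<phi> x)" by (rule int) (intro continuous_on_mult \<psi> \<phi>)
  have i3: "integrable M (\<lambda>x. \<psi> x * (\<phi> x - c))" by (rule int) (intro continuous_intros \<psi> \<phi>)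
  have "(\<integral>x. \<psi> x * (\<phi> x - c) \<partial>M) = (\<integral>x. \<psi> x * \<phi> x - c * \<psi> x \<partial>M)"
    by (simp add: algebra_simps)
  also have "\<dots> = (\<integral>x. \<psi> x * \<phi> x \<partial>M) - c * (\<integral>x. \<psi> x \<partial>M)" using i1 i2 by simp
  finally have "\<bar>(\<integral>x. \<psi> x * \<phi> x \<partial>M) - c * (\<integral>x. \<psi> x \<partial>M)\<bar> = \<bar>\<integral>x. \<psi> x * (\<phi> x - c) \<partial>M\<bar>" by simp
  also have "\<dots> \<le> (\<integral>x. \<bar>\<psi> x * (\<phi> x - c)\<bar> \<partial>M)" by (rule integral_abs_bound)
  also have "\<dots> \<le> (\<integral>x. w * \<psi> x \<partial>M)"
  proof (rule integral_mono)
    fix x show "\<bar>\<psi> x * (\<phi> x - c)\<bar> \<le> w * \<psi> x"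
      using \<phi>(2)[of x] \<psi>(2)[of x] mult_right_mono[of "\<bar>\<phi> x - c\<bar>" w "\<psi> x"]
      by (cases "\<psi> x = 0") (auto simp: abs_mult mult.commute)
  qed (use i1 i3 in auto)
  finally show ?thesis by simp
qed

text \<open>\<open>W\<close> and \<open>K\<close> stand for the energy densities of the regular and
  the singular part, later \<open>U (\<rho> x)\<close> and \<kappa> times the indicator of
  \<open>N\<close>. The assumption \<open>bound\<close> compares a single line with the energy on a
  piece of the partition; taking the best line on each piece and summing gives the energy
  inequality.\<close>

lemma smoothing:
  assumes supp: "msupport \<mu> \<subseteq> msupport \<nu>" and e: "0 < e"
    and U: "continuous_on {0..} U" "convex_on {0..} U" "U 0 = 0"
    and W: "integrable \<nu> W" and K: "integrable \<mu> K"
    and bound: "\<And>a b \<psi>. (a, b) \<in> affine_minorants U \<Longrightarrow> continuous_on UNIV \<psi> \<Longrightarrow> (\<And>x. 0 \<le> \<psi> x) \<Longrightarrow>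
      a * (\<integral>x. \<psi> x \<partial>\<mu>) + b * (\<integral>x. \<psi> x \<partial>\<nu>) \<le> (\<integral>x. \<psi> x * W x \<partial>\<nu>) + (\<integral>x. \<psi> x * K x \<partial>\<mu>)"
  obtains f where "continuous_on UNIV f" "\<And>x. 0 \<le> f x" "(\<integral>x. f x \<partial>\<nu>) = 1"
    "(\<integral>x. U (f x) \<partial>\<nu>) \<le> (\<integral>x. W x \<partial>\<nu>) + (\<integral>x. K x \<partial>\<mu>)"
    "\<And>\<phi> w. continuous_on UNIV \<phi> \<Longrightarrow> (\<And>x y. dist x y < e \<Longrightarrow> \<bar>\<phi> x - \<phi> y\<bar> \<le> w) \<Longrightarrow>
      \<bar>(\<integral>x. f x * \<phi> x \<partial>\<nu>) - (\<integral>x. \<phi> x \<partial>\<mu>)\<bar> \<le> 2 * w"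
proof (rule compact_partition_of_unity[OF compact_UNIV e])
  fix S :: "'a set" and \<psi> :: "'a \<Rightarrow> 'a \<Rightarrow> real"
  assume S: "finite S" and c\<psi>: "\<And>i. i \<in> S \<Longrightarrow> continuous_on UNIV (\<psi> i)" and \<psi>0: "\<And>i x. 0 \<le> \<psi> i x"
      and \<psi>1: "\<And>x. (\<Sum>i\<in>S. \<psi> i x) = 1" and \<psi>d: "\<And>i x. \<psi> i x \<noteq> 0 \<Longrightarrow> dist i x < e"
  define m where "m i = (\<integral>x. \<psi> i x \<partial>\<mu>)" for i
  define v where "v i = (\<integral>x. \<psi> i x \<partial>\<nu>)" for i
  \<comment> \<open>If \<open>v i = 0\<close> then \<open>m i = 0\<close> by the hypothesis on the supports, so the junk value \<open>c i = 0\<close> is harmless.\<close>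
  define c where "c i = m i / v i" for i
  define f where "f x = (\<Sum>i\<in>S. \<psi> i x * c i)" for x
  have i\<mu>: "integrable \<mu> (\<psi> i)" and i\<nu>: "integrable \<nu> (\<psi> i)" if "i \<in> S" for i
    using integrable_continuous[OF c\<psi>[OF that]] by auto
  have mv0: "0 \<le> m i" "0 \<le> v i" for i unfolding m_def v_def using \<psi>0 by (auto intro!: Bochner_Integration.integral_nonneg)
  then have c0: "0 \<le> c i" for i by (simp add: c_def)
  have cv: "c i * v i = m i" if "i \<in> S" for i
    using integral_eq_0_msupport[OF supp c\<psi>[OF that] \<psi>0] by (cases "v i = 0") (auto simp: c_def v_def m_def)
  have sum_m: "(\<Sum>i\<in>S. m i) = 1"
  proof -
    have "(\<Sum>i\<in>S. m i) = (\<integral>x. (\<Sum>i\<in>S. \<psi> i x) \<partial>\<mu>)"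
      unfolding m_def using i\<mu> by (intro Bochner_Integration.integral_sum[symmetric]) auto
    then show ?thesis by (simp add: \<psi>1 \<mu>.prob_space)
  qed
  show ?thesis
  proof (rule that[of f])
    show cf: "continuous_on UNIV f"
      unfolding f_def by (intro continuous_on_sum continuous_on_mult c\<psi> continuous_on_const)
    show f0: "0 \<le> f x" for x unfolding f_def by (intro sum_nonneg mult_nonneg_nonneg \<psi>0 c0)
    have "(\<integral>x. f x \<partial>\<nu>) = (\<Sum>i\<in>S. v i * c i)"
      unfolding f_def v_def using i\<nu> by (subst Bochner_Integration.integral_sum) auto
    also have "\<dots> = 1" using cv sum_m by (simp add: mult.commute)
    finally show "(\<integral>x. f x \<partial>\<nu>) = 1" .
    show "(\<integral>x. U (f x) \<partial>\<nu>) \<le> (\<integral>x. W x \<partial>\<nu>) + (\<integral>x. K x \<partial>\<mu>)"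
    proof -
      have "S \<noteq> {}" using \<psi>1[of undefined] by auto
      have cU: "continuous_on UNIV (\<lambda>x. U (f x))"
        by (rule continuous_on_compose2[OF U(1) cf]) (use f0 in auto)
      \<comment> \<open>Convexity of \<open>U\<close> at each point \<open>x\<close>, with the
        weights \<open>\<psi> i x\<close>, which add up to 1.\<close>
      have "(\<integral>x. U (f x) \<partial>\<nu>) \<le> (\<integral>x. (\<Sum>i\<in>S. \<psi> i x * U (c i)) \<partial>\<nu>)"
      proof (rule integral_mono)
        show "U (f x) \<le> (\<Sum>i\<in>S. \<psi> i x * U (c i))" for x
          using convex_on_sum[OF S \<open>S \<noteq> {}\<close> U(2) \<psi>1, of x c] \<psi>0 c0 by (simp add: f_def)
        show "integrable \<nu> (\<lambda>x. \<Sum>i\<in>S. \<psi> i x * U (c i))" using i\<nu> by auto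
      qed (rule integrable_continuous[OF cU])
      also have "\<dots> = (\<Sum>i\<in>S. v i * U (c i))"
        unfolding v_def using i\<nu> by (subst Bochner_Integration.integral_sum) auto
      also have "\<dots> \<le> (\<Sum>i\<in>S. (\<integral>x. \<psi> i x * W x \<partial>\<nu>) + (\<integral>x. \<psi> i x * K x \<partial>\<mu>))"
      proof (rule sum_mono)
        fix i assume i: "i \<in> S"
        let ?J = "(\<integral>x. \<psi> i x * W x \<partial>\<nu>) + (\<integral>x. \<psi> i x * K x \<partial>\<mu>)"
        have J: "a * m i + b * v i \<le> ?J" if "(a, b) \<in> affine_minorants U" for a b
          unfolding m_def v_def by (rule bound[OF that c\<psi>[OF i] \<psi>0])
        show "v i * U (c i) \<le> ?J"
        proof (rule ccontr)
          assume *: "\<not> v i * U (c i) \<le> ?J"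
          \<comment> \<open>If \<open>v i = 0\<close> then also \<open>m i = 0\<close>, so any one
            line yields \<open>0 \<le> ?J\<close>, which is the claim in this case.\<close>
          have "v i \<noteq> 0"
          proof
            assume "v i = 0"
            moreover obtain a b where "(a, b) \<in> affine_minorants U"
              using convex_on_subgradient[OF U(2) zero_less_one] by metis
            ultimately show False using J[of a b] * cv[OF i] by simp
          qed
          then have v: "0 < v i" using mv0(2)[of i] by simp
          then have "?J / v i < U (c i)" using * by (simp add: field_simps)
          \<comment> \<open>A line lying above \<open>?J / v i\<close> at \<open>c i\<close>
            contradicts \<open>J\<close> after multiplication by \<open>v i\<close>, because
            \<open>c i * v i = m i\<close>.\<close>
          then obtain a b where ab: "(a, b) \<in> affine_minorants U" "?J / v i < a * c i + b"
            using affine_minorant_close[OF U c0] by blast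
          then have "?J < a * (c i * v i) + b * v i" using v by (simp add: field_simps)
          then show False using J[OF ab(1)] cv[OF i] by simp
        qed
      qed
      also have "\<dots> = (\<integral>x. W x \<partial>\<nu>) + (\<integral>x. K x \<partial>\<mu>)"
      proof -
        have bd: "\<bar>\<psi> i x\<bar> \<le> 1" if "i \<in> S" for i x
          using member_le_sum[OF that _ S, of "\<lambda>i. \<psi> i x"] \<psi>0 \<psi>1[of x] by auto
        have m\<psi>: "\<psi> i \<in> borel_measurable borel" if "i \<in> S" for i
          using continuous_borel[OF c\<psi>[OF that]] .
        have IW: "integrable \<nu> (\<lambda>x. \<psi> i x * W x)" if "i \<in> S" for i
        proof (rule Bochner_Integration.integrable_bound[OF W])
          note [measurable] = m\<psi>[OF that] integrable_imp_borel(2)[OF W]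
          show "(\<lambda>x. \<psi> i x * W x) \<in> borel_measurable \<nu>" by measurable
          show "AE x in \<nu>. norm (\<psi> i x * W x) \<le> norm (W x)"
            using mult_right_mono[OF bd[OF that]] by (intro AE_I2) (simp add: abs_mult)
        qed
        have IK: "integrable \<mu> (\<lambda>x. \<psi> i x * K x)" if "i \<in> S" for i
        proof (rule Bochner_Integration.integrable_bound[OF K])
          note [measurable] = m\<psi>[OF that] integrable_imp_borel(1)[OF K]
          show "(\<lambda>x. \<psi> i x * K x) \<in> borel_measurable \<mu>" by measurable
          show "AE x in \<mu>. norm (\<psi> i x * K x) \<le> norm (K x)"
            using mult_right_mono[OF bd[OF that]] by (intro AE_I2) (simp add: abs_mult)
        qed
        have "(\<Sum>i\<in>S. (\<integral>x. \<psi> i x * W x \<partial>\<nu>)) = (\<integral>x. (\<Sum>i\<in>S. \<psi> i x * W x) \<partial>\<nu>)"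
          using IW by (subst Bochner_Integration.integral_sum) auto
        moreover have "(\<Sum>i\<in>S. (\<integral>x. \<psi> i x * K x \<partial>\<mu>)) = (\<integral>x. (\<Sum>i\<in>S. \<psi> i x * K x) \<partial>\<mu>)"
          using IK by (subst Bochner_Integration.integral_sum) auto
        ultimately show ?thesis by (simp add: sum.distrib \<psi>1 flip: sum_distrib_right)
      qed
      finally show ?thesis .
    qed
    fix \<phi> :: "'a \<Rightarrow> real" and w :: real
    assume \<phi>: "continuous_on UNIV \<phi>" and w: "\<And>x y. dist x y < e \<Longrightarrow> \<bar>\<phi> x - \<phi> y\<bar> \<le> w"
    have I: "integrable \<mu> (\<lambda>x. \<psi> i x * \<phi> x)" "integrable \<nu> (\<lambda>x. \<psi> i x * \<phi> x)" if "i \<in> S" for i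
      using integrable_continuous[OF continuous_on_mult[OF c\<psi>[OF that] \<phi>]] by auto
    have "(\<integral>x. f x * \<phi> x \<partial>\<nu>) = (\<integral>x. (\<Sum>i\<in>S. c i * (\<psi> i x * \<phi> x)) \<partial>\<nu>)"
      by (simp add: f_def sum_distrib_right sum_distrib_left mult_ac)
    also have "\<dots> = (\<Sum>i\<in>S. c i * (\<integral>x. \<psi> i x * \<phi> x \<partial>\<nu>))"
      using I by (subst Bochner_Integration.integral_sum) auto
    finally have 1: "(\<integral>x. f x * \<phi> x \<partial>\<nu>) = (\<Sum>i\<in>S. c i * (\<integral>x. \<psi> i x * \<phi> x \<partial>\<nu>))" .
    have "(\<integral>x. \<phi> x \<partial>\<mu>) = (\<integral>x. (\<Sum>i\<in>S. \<psi> i x * \<phi> x) \<partial>\<mu>)"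
      by (simp add: \<psi>1 flip: sum_distrib_right)
    also have "\<dots> = (\<Sum>i\<in>S. (\<integral>x. \<psi> i x * \<phi> x \<partial>\<mu>))"
      using I by (subst Bochner_Integration.integral_sum) auto
    finally have 2: "(\<integral>x. \<phi> x \<partial>\<mu>) = (\<Sum>i\<in>S. (\<integral>x. \<psi> i x * \<phi> x \<partial>\<mu>))" .
    have "\<bar>(\<integral>x. f x * \<phi> x \<partial>\<nu>) - (\<integral>x. \<phi> x \<partial>\<mu>)\<bar>
      \<le> (\<Sum>i\<in>S. \<bar>c i * (\<integral>x. \<psi> i x * \<phi> x \<partial>\<nu>) - (\<integral>x. \<psi> i x * \<phi> x \<partial>\<mu>)\<bar>)"
      unfolding 1 2 by (subst sum_subtractf[symmetric]) (rule sum_abs)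
    \<comment> \<open>Both integrals over the piece \<open>i\<close> are compared with
      \<open>\<phi> i\<close> times its mass. Multiplying the \<nu>-estimate by \<open>c i\<close>
      turns \<open>v i\<close> into \<open>m i\<close>; the values at the centre then cancel, and
      each of the two estimates costs \<open>w * m i\<close>.\<close>
    also have "\<dots> \<le> (\<Sum>i\<in>S. 2 * w * m i)"
    proof (rule sum_mono)
      fix i assume i: "i \<in> S"
      have w': "\<bar>\<phi> x - \<phi> i\<bar> \<le> w" if "\<psi> i x \<noteq> 0" for x
        using w[of x i] \<psi>d[OF that] by (simp add: dist_commute)
      let ?n = "(\<integral>x. \<psi> i x * \<phi> x \<partial>\<nu>)" and ?m = "(\<integral>x. \<psi> i x * \<phi> x \<partial>\<mu>)"
      have n: "\<bar>?n - \<phi> i * v i\<bar> \<le> w * v i"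
        unfolding v_def using w' by (intro integral_localized c\<psi> i \<psi>0 \<phi>) auto
      have m: "\<bar>?m - \<phi> i * m i\<bar> \<le> w * m i"
        unfolding m_def using w' by (intro integral_localized c\<psi> i \<psi>0 \<phi>) auto
      have "\<bar>c i * (?n - \<phi> i * v i)\<bar> \<le> c i * (w * v i)"
        using mult_left_mono[OF n c0] c0[of i] by (simp add: abs_mult)
      moreover have "c i * (?n - \<phi> i * v i) = c i * ?n - \<phi> i * m i"
        using cv[OF i] by (simp add: algebra_simps)
      moreover have "c i * (w * v i) = w * m i" using cv[OF i] by (simp add: algebra_simps)
      ultimately show "\<bar>c i * ?n - ?m\<bar> \<le> 2 * w * m i" using m by linarith
    qed
    also have "\<dots> = 2 * w" using sum_m by (simp flip: sum_distrib_left)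
    finally show "\<bar>(\<integral>x. f x * \<phi> x \<partial>\<nu>) - (\<integral>x. \<phi> x \<partial>\<mu>)\<bar> \<le> 2 * w" .
  qed
qed

end

section \<open>The Lebesgue decomposition\<close>

text \<open>At each point \<open>x\<close>, a line with the largest score \<open>v x\<close> among
  \<open>l 0\<close>, ..., \<open>l n\<close>. The recursion changes the family by a single switch
  per step, which is the operation that \<open>approximable_minorant_switch\<close> handles.\<close>

primrec best_minorant :: "('a \<Rightarrow> real \<times> real \<Rightarrow> real) \<Rightarrow> (nat \<Rightarrow> real \<times> real) \<Rightarrow> nat \<Rightarrow> 'a \<Rightarrow> real \<times> real" where
  "best_minorant v l 0 = (\<lambda>x. l 0)"
| "best_minorant v l (Suc n) = (\<lambda>x. if v x (best_minorant v l n x) < v x (l (Suc n))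
     then l (Suc n) else best_minorant v l n x)"

lemma best_minorant_ge: "m \<le> n \<Longrightarrow> v x (l m) \<le> v x (best_minorant v l n x)"
proof (induction n)
  case (Suc n)
  then show ?case by (cases "m = Suc n") auto
qed simp

lemma best_minorant_mem: "best_minorant v l n x \<in> range l"
  by (induction n) auto

lemma tendsto_best_minorant:
  assumes "\<And>p. p \<in> range l \<Longrightarrow> v x p \<le> T" "\<And>c. c < T \<Longrightarrow> \<exists>n. c < v x (l n)"
  shows "(\<lambda>n. v x (best_minorant v l n x)) \<longlonglongrightarrow> (T :: real)"
proof (rule order_tendstoI)
  fix c assume "c < T"
  then obtain m where "c < v x (l m)" using assms(2) by blast
  then have "c < v x (best_minorant v l n x)" if "m \<le> n" for n
    using best_minorant_ge[OF that, of v x l] by linarith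
  then show "eventually (\<lambda>n. c < v x (best_minorant v l n x)) sequentially"
    by (auto simp: eventually_sequentially)
next
  fix c assume "T < c"
  then show "eventually (\<lambda>n. v x (best_minorant v l n x) < c) sequentially"
    by (intro always_eventually allI le_less_trans[OF assms(1)[OF best_minorant_mem]])
qed

lemma ereal_integral_eq:
  assumes "integrable M g"
  shows "ereal_integral M g = ereal (\<integral>x. g x \<partial>M)"
proof -
  obtain p q where "(\<integral>\<^sup>+x. ennreal (g x) \<partial>M) = ennreal p" "0 \<le> p"
    "(\<integral>\<^sup>+x. ennreal (- g x) \<partial>M) = ennreal q" "0 \<le> q"
    using assms unfolding real_integrable_def
    by (metis ennreal_cases infinity_ennreal_def)
  then show ?thesis
    using assms by (simp add: ereal_integral_def real_lebesgue_integral_def enn2ereal_ennreal)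
qed

text \<open>A \<nu>-null set \<open>N\<close> carries the singular part, while the regular part
  vanishes on \<open>N\<close>. So the two parts are \<mu> restricted to \<open>N\<close> and to its
  complement, and from here on a set takes the place of the measure \<open>\<mu>s\<close>.\<close>

lemma mutually_singular_split:
  assumes \<nu>\<mu>: "sets \<mu> = sets \<nu>" and dec: "lebesgue_decomposition \<nu> \<mu> \<rho> \<mu>s"
  obtains N where "N \<in> sets \<nu>" "emeasure \<nu> N = 0" "emeasure \<mu>s (space \<nu>) = emeasure \<mu> N"
    "density \<nu> (\<lambda>x. ennreal (\<rho> x)) = density \<mu> (\<lambda>x. ennreal (indicat_real (- N) x))"
proof -
  let ?D = "density \<nu> (\<lambda>x. ennreal (\<rho> x))"
  have \<rho>: "\<rho> \<in> borel_measurable \<nu>" and ss: "sets \<mu>s = sets \<nu>"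
    and eq: "\<And>A. A \<in> sets \<nu> \<Longrightarrow> emeasure \<mu> A = emeasure ?D A + emeasure \<mu>s A"
    using dec by (auto simp: lebesgue_decomposition_def)
  obtain N where N: "N \<in> sets \<nu>" "emeasure \<nu> N = 0" "emeasure \<mu>s (space \<nu> - N) = 0"
    using dec by (auto simp: lebesgue_decomposition_def mutually_singular_def)
  have DN: "emeasure ?D A = 0" if "A \<in> sets \<nu>" "A \<subseteq> N" for A
  proof -
    have "A \<in> null_sets \<nu>" using null_sets_subset[of N \<nu> A] N that by auto
    then have "A \<in> null_sets ?D"
      using absolutely_continuousI_density[of "\<lambda>x. ennreal (\<rho> x)" \<nu>] \<rho> by (auto simp: absolutely_continuous_def)
    then show ?thesis by auto
  qed
  have sN: "emeasure \<mu>s A = 0" if "A \<in> sets \<nu>" "A \<inter> N = {}" for A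
  proof -
    have "emeasure \<mu>s A \<le> emeasure \<mu>s (space \<nu> - N)"
      using sets.sets_into_space[OF that(1)] that N ss by (intro emeasure_mono) auto
    then show ?thesis using N by simp
  qed
  show ?thesis
  proof (rule that[OF N(1,2)])
    have "emeasure \<mu>s (space \<nu>) = emeasure \<mu>s N + emeasure \<mu>s (space \<nu> - N)"
      using N(1) ss sets.sets_into_space[OF N(1)]
      by (subst plus_emeasure) (auto intro: arg_cong[where f = "emeasure \<mu>s"])
    then show "emeasure \<mu>s (space \<nu>) = emeasure \<mu> N" using N eq[OF N(1)] DN[OF N(1)] by simp
    show "?D = density \<mu> (\<lambda>x. ennreal (indicat_real (- N) x))"
    proof (rule measure_eqI)
      fix A assume "A \<in> sets ?D"
      then have A: "A \<in> sets \<nu>" by simp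
      have "emeasure ?D A = emeasure ?D (A - N) + emeasure ?D (A \<inter> N)"
        using A N(1) by (subst plus_emeasure) (auto intro: arg_cong[where f = "emeasure ?D"])
      also have "\<dots> = emeasure \<mu> (A - N)"
        using A N(1) DN[of "A \<inter> N"] sN[of "A - N"] eq[of "A - N"] by auto
      also have "\<dots> = (\<integral>\<^sup>+x. indicator (A - N) x \<partial>\<mu>)" using A N(1) \<nu>\<mu> by simp
      also have "\<dots> = (\<integral>\<^sup>+x. ennreal (indicat_real (- N) x) * indicator A x \<partial>\<mu>)"
        by (intro nn_integral_cong) (auto split: split_indicator)
      also have "\<dots> = emeasure (density \<mu> (\<lambda>x. ennreal (indicat_real (- N) x))) A"
      proof (rule emeasure_density[symmetric])
        have "(\<lambda>x. 1 - indicat_real N x) \<in> borel_measurable \<mu>" using N(1) \<nu>\<mu> by simp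
        moreover have "(\<lambda>x. 1 - indicat_real N x) = indicat_real (- N)"
          by (auto split: split_indicator)
        ultimately show "(\<lambda>x. ennreal (indicat_real (- N) x)) \<in> borel_measurable \<mu>" by simp
      qed (use A \<nu>\<mu> in simp)
      finally show "emeasure ?D A = emeasure (density \<mu> (\<lambda>x. ennreal (indicat_real (- N) x))) A" .
    qed (simp add: \<nu>\<mu>)
  qed
qed

locale split_prob_pair = compact_prob_pair \<mu> \<nu> for \<mu> \<nu> :: "'a::metric_space measure" +
  fixes \<rho> :: "'a \<Rightarrow> real" and N :: "'a set"
  assumes \<rho>_borel: "\<rho> \<in> borel_measurable borel" and \<rho>_nonneg: "\<And>x. 0 \<le> \<rho> x"
    and N_borel: "N \<in> sets borel" and N_null: "emeasure \<nu> N = 0"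
    and density_eq: "density \<nu> (\<lambda>x. ennreal (\<rho> x)) = density \<mu> (\<lambda>x. ennreal (indicat_real (- N) x))"
begin

lemmas [measurable] = \<rho>_borel N_borel

lemma AE_not_N: "AE x in \<nu>. x \<notin> N"
  using N_null N_borel by (intro AE_not_in) (auto simp: null_sets_def sets_\<nu>)

text \<open>Off \<open>N\<close> the measure \<mu> has density \<rho> with respect to \<nu>; on
  \<open>N\<close> it is kept as it stands.\<close>

lemma integral_split:
  assumes h: "(h :: 'a \<Rightarrow> real) \<in> borel_measurable borel" "\<And>x. \<bar>h x\<bar> \<le> B"
  shows integrable_\<rho>_mult: "integrable \<nu> (\<lambda>x. \<rho> x * h x)"
    and integrable_N_mult: "integrable \<mu> (\<lambda>x. h x * indicator N x)"
    and integral_split_eq: "(\<integral>x. h x \<partial>\<mu>) = (\<integral>x. \<rho> x * h x \<partial>\<nu>) + (\<integral>x. h x * indicator N x \<partial>\<mu>)"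
proof -
  note [measurable] = h(1)
  have cN [measurable]: "- N \<in> sets borel" using N_borel by auto
  have B: "0 \<le> B" using h(2)[of undefined] by linarith
  have 1: "integrable \<mu> (\<lambda>x. indicat_real (- N) x * h x)"
    by (rule integrable_bounded[of _ B], measurable) (use h(2) B in \<open>auto split: split_indicator\<close>)
  show 2: "integrable \<mu> (\<lambda>x. h x * indicator N x)"
    by (rule integrable_bounded[of _ B], measurable) (use h(2) B in \<open>auto split: split_indicator\<close>)
  have "integrable (density \<mu> (\<lambda>x. ennreal (indicat_real (- N) x))) h"
    using 1 by (subst integrable_density) auto
  then show "integrable \<nu> (\<lambda>x. \<rho> x * h x)"
    unfolding density_eq[symmetric] by (subst (asm) integrable_density) (auto simp: \<rho>_nonneg)
  have "(\<integral>x. \<rho> x * h x \<partial>\<nu>) = integral\<^sup>L (density \<nu> (\<lambda>x. ennreal (\<rho> x))) h"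
    by (subst integral_density) (auto simp: \<rho>_nonneg)
  also have "\<dots> = (\<integral>x. indicat_real (- N) x * h x \<partial>\<mu>)"
    unfolding density_eq by (subst integral_density) auto
  finally have "(\<integral>x. \<rho> x * h x \<partial>\<nu>) + (\<integral>x. h x * indicator N x \<partial>\<mu>)
    = (\<integral>x. indicat_real (- N) x * h x + h x * indicator N x \<partial>\<mu>)"
    using 1 2 by simp
  also have "\<dots> = (\<integral>x. h x \<partial>\<mu>)"
    by (intro Bochner_Integration.integral_cong) (auto split: split_indicator)
  finally show "(\<integral>x. h x \<partial>\<mu>) = (\<integral>x. \<rho> x * h x \<partial>\<nu>) + (\<integral>x. h x * indicator N x \<partial>\<mu>)" by simp
qed

lemma integrable_\<rho>: "integrable \<nu> \<rho>"
  using integrable_\<rho>_mult[of "\<lambda>_. 1" 1] by simp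

text \<open>Off \<open>N\<close> the line is evaluated at \<open>\<rho> x\<close>. On
  \<open>N\<close> only its slope counts, since the intercept is integrated against \<nu>, and the
  slope is at most \<kappa>. This supplies the assumption \<open>bound\<close> of
  \<open>smoothing\<close>.\<close>

lemma minorant_bound:
  assumes W: "integrable \<nu> (\<lambda>x. U (\<rho> x))"
    and ab: "(a, b) \<in> affine_minorants U" and \<kappa>: "emeasure \<mu> N \<noteq> 0 \<Longrightarrow> a \<le> \<kappa>"
    and \<psi>: "continuous_on UNIV \<psi>" "\<And>x. 0 \<le> \<psi> x"
  shows "a * (\<integral>x. \<psi> x \<partial>\<mu>) + b * (\<integral>x. \<psi> x \<partial>\<nu>)
    \<le> (\<integral>x. \<psi> x * U (\<rho> x) \<partial>\<nu>) + (\<integral>x. \<psi> x * (\<kappa> * indicator N x) \<partial>\<mu>)"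
proof -
  obtain B where B: "\<And>x. \<bar>\<psi> x\<bar> \<le> B" using continuous_bounded[OF \<psi>(1)] by metis
  note [measurable] = continuous_borel[OF \<psi>(1)] integrable_imp_borel(2)[OF W]
  note split = integral_split[OF continuous_borel[OF \<psi>(1)] B]
  have W': "integrable \<nu> (\<lambda>x. \<psi> x * U (\<rho> x))"
  proof (rule Bochner_Integration.integrable_bound)
    show "integrable \<nu> (\<lambda>x. B * U (\<rho> x))" using W by simp
    show "AE x in \<nu>. norm (\<psi> x * U (\<rho> x)) \<le> norm (B * U (\<rho> x))"
      using B by (intro AE_I2) (auto simp: abs_mult intro!: mult_right_mono order_trans[OF B])
  qed measurable
  have "a * (\<integral>x. \<rho> x * \<psi> x \<partial>\<nu>) + b * (\<integral>x. \<psi> x \<partial>\<nu>) = (\<integral>x. a * (\<rho> x * \<psi> x) + b * \<psi> x \<partial>\<nu>)"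
    using split(1) integrable_continuous(2)[OF \<psi>(1)] by simp
  also have "\<dots> \<le> (\<integral>x. \<psi> x * U (\<rho> x) \<partial>\<nu>)"
  proof (rule integral_mono[OF _ W'])
    show "integrable \<nu> (\<lambda>x. a * (\<rho> x * \<psi> x) + b * \<psi> x)"
      using split(1) integrable_continuous(2)[OF \<psi>(1)] by simp
    show "a * (\<rho> x * \<psi> x) + b * \<psi> x \<le> \<psi> x * U (\<rho> x)" for x
      using mult_left_mono[OF affine_minorantsD[OF ab \<rho>_nonneg[of x]] \<psi>(2)[of x]] by (simp add: algebra_simps)
  qed
  finally have 1: "a * (\<integral>x. \<rho> x * \<psi> x \<partial>\<nu>) + b * (\<integral>x. \<psi> x \<partial>\<nu>) \<le> (\<integral>x. \<psi> x * U (\<rho> x) \<partial>\<nu>)" .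
  have 2: "a * (\<integral>x. \<psi> x * indicator N x \<partial>\<mu>) \<le> \<kappa> * (\<integral>x. \<psi> x * indicator N x \<partial>\<mu>)"
  proof (cases "emeasure \<mu> N = 0")
    case True
    then have "AE x in \<mu>. x \<notin> N" using N_borel by (intro AE_not_in) (auto simp: null_sets_def sets_\<mu>)
    then have "(\<integral>x. \<psi> x * indicator N x \<partial>\<mu>) = 0"
      by (intro integral_eq_zero_AE) (auto elim!: eventually_mono)
    then show ?thesis by simp
  next
    case False
    then show ?thesis
      using \<kappa> \<psi>(2) by (intro mult_right_mono Bochner_Integration.integral_nonneg) auto
  qed
  have 3: "(\<integral>x. \<psi> x * (\<kappa> * indicator N x) \<partial>\<mu>) = \<kappa> * (\<integral>x. \<psi> x * indicator N x \<partial>\<mu>)"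
    by (simp add: mult.left_commute)
  show ?thesis using 1 2 unfolding 3 split(3) by (simp add: algebra_simps)
qed

text \<open>The best of the first lines, chosen point by point, has values increasing to
  \<open>U (\<rho> x)\<close> off \<open>N\<close> and, if \<open>N\<close> has positive \<mu>-mass,
  slopes increasing to \<kappa> on \<open>N\<close>. Passing to the limit under both integrals gives
  a family whose value exceeds \<open>c\<close>.\<close>

lemma approximable_minorant_sup:
  assumes U: "continuous_on {0..} U" "convex_on {0..} U" "U 0 = 0"
    and W: "integrable \<nu> (\<lambda>x. U (\<rho> x))"
    and \<kappa>1: "\<And>a b. emeasure \<mu> N \<noteq> 0 \<Longrightarrow> (a, b) \<in> affine_minorants U \<Longrightarrow> a \<le> \<kappa>"
    and \<kappa>2: "\<And>c. emeasure \<mu> N \<noteq> 0 \<Longrightarrow> c < \<kappa> \<Longrightarrow> \<exists>a b. (a, b) \<in> affine_minorants U \<and> c < a"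
    and c: "c < (\<integral>x. U (\<rho> x) \<partial>\<nu>) + (\<integral>x. \<kappa> * indicator N x \<partial>\<mu>)"
  shows "\<exists>\<alpha> \<beta>. approximable_minorant U \<mu> \<nu> \<alpha> \<beta> \<and> c < (\<integral>x. \<alpha> x \<partial>\<mu>) + (\<integral>x. \<beta> x \<partial>\<nu>)"
proof (rule countable_affine_minorants[OF U])
  fix l :: "nat \<Rightarrow> real \<times> real"
  assume l: "\<And>n. l n \<in> affine_minorants U"
    and close: "\<And>r c. 0 \<le> r \<Longrightarrow> c < U r \<Longrightarrow> \<exists>n. c < fst (l n) * r + snd (l n)"
    and steep: "\<And>a b c. (a, b) \<in> affine_minorants U \<Longrightarrow> c < a \<Longrightarrow> \<exists>n. c < fst (l n)"
  \<comment> \<open>The score is the contribution of a line at \<open>x\<close> to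
    \<integral>\<alpha> d\<mu> + \<integral>\<beta> d\<nu>: off \<open>N\<close> both integrals
    reduce to \<nu>, with the factor \<open>\<rho> x\<close> at the slope, and on the \<nu>-null set
    \<open>N\<close> the slope alone contributes.\<close>
  define v where "v x p = (if x \<in> N then fst p else fst p * \<rho> x + snd p)" for x and p :: "real \<times> real"
  define \<alpha> where "\<alpha> n x = fst (best_minorant v l n x)" for n x
  define \<beta> where "\<beta> n x = snd (best_minorant v l n x)" for n x
  have app: "approximable_minorant U \<mu> \<nu> (\<alpha> n) (\<beta> n)" for n
  proof (induction n)
    case 0
    show ?case using l[of 0] by (simp add: \<alpha>_def \<beta>_def approximable_minorant_const)
  next
    case (Suc n)
    define E where "E = {x. v x (best_minorant v l n x) < v x (l (Suc n))}"
    have [measurable]: "\<alpha> n \<in> borel_measurable borel" "\<beta> n \<in> borel_measurable borel"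
      using Suc by (auto simp: approximable_minorant_def)
    have "E = {x. (if x \<in> N then \<alpha> n x else \<alpha> n x * \<rho> x + \<beta> n x)
        < (if x \<in> N then fst (l (Suc n)) else fst (l (Suc n)) * \<rho> x + snd (l (Suc n)))}"
      by (simp add: E_def v_def \<alpha>_def \<beta>_def)
    also have "\<dots> \<in> sets borel" by measurable
    finally have E: "E \<in> sets borel" .
    have "(fst (l (Suc n)), snd (l (Suc n))) \<in> affine_minorants U" using l by simp
    from approximable_minorant_switch[OF approximable_minorant_const[OF this] Suc E]
    moreover have "\<alpha> (Suc n) = (\<lambda>x. if x \<in> E then fst (l (Suc n)) else \<alpha> n x)"
      "\<beta> (Suc n) = (\<lambda>x. if x \<in> E then snd (l (Suc n)) else \<beta> n x)"
      by (auto simp: \<alpha>_def \<beta>_def E_def)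
    ultimately show ?case by simp
  qed
  have mb: "\<alpha> n \<in> borel_measurable borel" "\<beta> n \<in> borel_measurable borel"
    "\<exists>B. \<forall>x. \<bar>\<alpha> n x\<bar> \<le> B \<and> \<bar>\<beta> n x\<bar> \<le> B" for n
    using app[of n] by (auto simp: approximable_minorant_def)
  note [measurable] = mb(1,2) integrable_imp_borel(2)[OF W]
  have sp: "integrable \<nu> (\<lambda>x. \<rho> x * \<alpha> n x)"
    "(\<integral>x. \<alpha> n x \<partial>\<mu>) = (\<integral>x. \<rho> x * \<alpha> n x \<partial>\<nu>) + (\<integral>x. \<alpha> n x * indicator N x \<partial>\<mu>)"
    "integrable \<nu> (\<beta> n)" for n
  proof -
    obtain B where B: "\<And>x. \<bar>\<alpha> n x\<bar> \<le> B" "\<And>x. \<bar>\<beta> n x\<bar> \<le> B" using mb(3)[of n] by blast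
    show "integrable \<nu> (\<lambda>x. \<rho> x * \<alpha> n x)"
      "(\<integral>x. \<alpha> n x \<partial>\<mu>) = (\<integral>x. \<rho> x * \<alpha> n x \<partial>\<nu>) + (\<integral>x. \<alpha> n x * indicator N x \<partial>\<mu>)"
      using integral_split[OF mb(1) B(1)] by auto
    show "integrable \<nu> (\<beta> n)" by (rule integrable_bounded(2)[OF mb(2) B(2)])
  qed
  have rl: "(fst p, snd p) \<in> affine_minorants U" if "p \<in> range l" for p using l that by auto
  have "(\<lambda>n. \<integral>x. \<rho> x * \<alpha> n x + \<beta> n x \<partial>\<nu>) \<longlonglongrightarrow> (\<integral>x. U (\<rho> x) \<partial>\<nu>)"
  \<comment> \<open>Off \<open>N\<close> the values lie between that of the first line
    \<open>l 0\<close> and \<open>U (\<rho> x)\<close>, so the sum of the two absolute values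
    dominates.\<close>
  proof (rule integral_dominated_convergence[where w = "\<lambda>x. \<bar>fst (l 0) * \<rho> x + snd (l 0)\<bar> + \<bar>U (\<rho> x)\<bar>"])
    show "integrable \<nu> (\<lambda>x. \<bar>fst (l 0) * \<rho> x + snd (l 0)\<bar> + \<bar>U (\<rho> x)\<bar>)"
      using integrable_\<rho> W by simp
    have up: "v x p \<le> U (\<rho> x)" if "x \<notin> N" "p \<in> range l" for x p
      using affine_minorantsD[OF rl[OF that(2)] \<rho>_nonneg[of x]] that(1) by (simp add: v_def)
    have veq: "\<rho> x * \<alpha> n x + \<beta> n x = v x (best_minorant v l n x)" if "x \<notin> N" for n x
      using that by (simp add: v_def \<alpha>_def \<beta>_def)
    show "AE x in \<nu>. (\<lambda>n. \<rho> x * \<alpha> n x + \<beta> n x) \<longlonglongrightarrow> U (\<rho> x)"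
      using AE_not_N
    proof eventually_elim
      case (elim x)
      have "(\<lambda>n. v x (best_minorant v l n x)) \<longlonglongrightarrow> U (\<rho> x)"
        using up[OF elim] close[OF \<rho>_nonneg[of x]] elim
        by (intro tendsto_best_minorant) (auto simp: v_def)
      then show ?case by (simp only: veq[OF elim])
    qed
    show "AE x in \<nu>. norm (\<rho> x * \<alpha> n x + \<beta> n x) \<le> \<bar>fst (l 0) * \<rho> x + snd (l 0)\<bar> + \<bar>U (\<rho> x)\<bar>" for n
      using AE_not_N
    proof eventually_elim
      case (elim x)
      have "v x (l 0) \<le> v x (best_minorant v l n x)" by (rule best_minorant_ge) simp
      moreover have "v x (best_minorant v l n x) \<le> U (\<rho> x)" by (rule up[OF elim best_minorant_mem])
      moreover have "v x (l 0) = fst (l 0) * \<rho> x + snd (l 0)" using elim by (simp add: v_def)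
      ultimately show ?case unfolding veq[OF elim] real_norm_def by linarith
    qed
  qed measurable
  moreover have "(\<lambda>n. \<integral>x. \<alpha> n x * indicator N x \<partial>\<mu>) \<longlonglongrightarrow> (\<integral>x. \<kappa> * indicator N x \<partial>\<mu>)"
  \<comment> \<open>In the null case nothing relates the slopes to \<kappa>, but all integrands
    vanish almost everywhere.\<close>
  proof (cases "emeasure \<mu> N = 0")
    case True
    then have "AE x in \<mu>. x \<notin> N" using N_borel by (intro AE_not_in) (auto simp: null_sets_def sets_\<mu>)
    then have 0: "(\<integral>x. h x * indicat_real N x \<partial>\<mu>) = 0" for h
      by (intro integral_eq_zero_AE) (auto elim!: eventually_mono)
    show ?thesis unfolding 0 by (rule tendsto_const)
  next
    case False
    have up: "v x p \<le> \<kappa>" if "x \<in> N" "p \<in> range l" for x p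
      using \<kappa>1[OF False rl[OF that(2)]] that(1) by (simp add: v_def)
    have veq: "\<alpha> n x = v x (best_minorant v l n x)" if "x \<in> N" for n x
      using that by (simp add: v_def \<alpha>_def)
    show ?thesis
    proof (rule integral_dominated_convergence[where w = "\<lambda>x. \<bar>fst (l 0)\<bar> + \<bar>\<kappa>\<bar>"])
      show "AE x in \<mu>. (\<lambda>n. \<alpha> n x * indicator N x) \<longlonglongrightarrow> \<kappa> * indicator N x"
      proof (rule AE_I2)
        fix x
        show "(\<lambda>n. \<alpha> n x * indicat_real N x) \<longlonglongrightarrow> \<kappa> * indicator N x"
        proof (cases "x \<in> N")
          case True
          have "(\<lambda>n. v x (best_minorant v l n x)) \<longlonglongrightarrow> \<kappa>"
          proof (rule tendsto_best_minorant)
            show "\<exists>n. c < v x (l n)" if "c < \<kappa>" for c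
              using \<kappa>2[OF False that] steep True by (auto simp: v_def)
          qed (rule up[OF True])
          then show ?thesis using True by (simp add: veq)
        qed simp
      qed
      show "AE x in \<mu>. norm (\<alpha> n x * indicator N x) \<le> \<bar>fst (l 0)\<bar> + \<bar>\<kappa>\<bar>" for n
      proof (rule AE_I2)
        fix x
        show "norm (\<alpha> n x * indicator N x) \<le> \<bar>fst (l 0)\<bar> + \<bar>\<kappa>\<bar>"
        proof (cases "x \<in> N")
          case True
          have "v x (l 0) \<le> v x (best_minorant v l n x)" by (rule best_minorant_ge) simp
          moreover have "v x (best_minorant v l n x) \<le> \<kappa>" by (rule up[OF True best_minorant_mem])
          moreover have "v x (l 0) = fst (l 0)" using True by (simp add: v_def)
          ultimately show ?thesis using True by (simp add: veq)
        qed simp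
      qed
      show "(\<lambda>x. \<kappa> * indicat_real N x) \<in> borel_measurable \<mu>"
        "(\<lambda>x. \<alpha> n x * indicat_real N x) \<in> borel_measurable \<mu>" for n
        using N_borel by (intro borel_measurable_times borel_measurable_indicator; simp add: sets_\<mu> measurable_cong_sets[OF sets_\<mu> refl] mb(1))+
      show "integrable \<mu> (\<lambda>x. \<bar>fst (l 0)\<bar> + \<bar>\<kappa>\<bar>)" by (rule \<mu>.integrable_const)
    qed
  qed
  ultimately have "(\<lambda>n. (\<integral>x. \<rho> x * \<alpha> n x + \<beta> n x \<partial>\<nu>) + (\<integral>x. \<alpha> n x * indicator N x \<partial>\<mu>))
    \<longlonglongrightarrow> (\<integral>x. U (\<rho> x) \<partial>\<nu>) + (\<integral>x. \<kappa> * indicator N x \<partial>\<mu>)" by (rule tendsto_add)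
  from order_tendstoD(1)[OF this c]
  obtain n where "c < (\<integral>x. \<rho> x * \<alpha> n x + \<beta> n x \<partial>\<nu>) + (\<integral>x. \<alpha> n x * indicator N x \<partial>\<mu>)"
    by (auto simp: eventually_sequentially)
  also have "\<dots> = (\<integral>x. \<alpha> n x \<partial>\<mu>) + (\<integral>x. \<beta> n x \<partial>\<nu>)" using sp by simp
  finally show ?thesis using app by blast
qed

end

text \<open>The null measure serves as singular part, and \<open>\<infinity> * 0 = 0\<close> removes
  the slope term even when the slope is infinite. By compactness \<open>U (f x)\<close> is
  integrable, so the extended integral is a real one.\<close>

lemma U_functional_density:
  assumes U: "continuous_on {0..} U" and \<nu>: "compact (UNIV :: 'a::metric_space set)"
    "prob_space \<nu>" "sets \<nu> = sets borel"
    and f: "continuous_on UNIV f" "\<And>x::'a. 0 \<le> f x" "prob_space (density \<nu> (\<lambda>x. ennreal (f x)))"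
  shows "U_functional U \<nu> (density \<nu> (\<lambda>x. ennreal (f x))) = ereal (\<integral>x. U (f x) \<partial>\<nu>)"
proof -
  interpret \<nu>: prob_space \<nu> by fact
  interpret f: prob_space "density \<nu> (\<lambda>x. ennreal (f x))" by fact
  have cU: "continuous_on UNIV (\<lambda>x. U (f x))"
    by (rule continuous_on_compose2[OF U f(1)]) (use f(2) in auto)
  have "f \<in> borel_measurable \<nu>"
    using borel_measurable_continuous_onI[OF f(1)] by (simp cong: measurable_cong_sets add: \<nu>(3))
  moreover have "mutually_singular \<nu> (null_measure \<nu>)"
    unfolding mutually_singular_def by (intro bexI[of _ "{}"]) auto
  ultimately have "lebesgue_decomposition \<nu> (density \<nu> (\<lambda>x. ennreal (f x))) f (null_measure \<nu>)"
    using f(2) by (simp add: lebesgue_decomposition_def)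
  from U_functional_eq[OF \<nu>.finite_measure_axioms f.finite_measure_axioms this, of U]
  show ?thesis
    using integrable_continuous_compact[OF \<nu>(1) \<nu>.finite_measure_axioms \<nu>(3) cU]
    by (simp add: ereal_integral_eq zero_ennreal.rep_eq)
qed

text \<open>\<open>\<kappa>\<close> is junk (\<open>0\<close>) when the slope at infinity is \<open>\<infinity>\<close>, but then finiteness forces
  \<open>\<mu> N = 0\<close>.\<close>

lemma U_functional_finite_eq:
  assumes "split_prob_pair \<mu> \<nu> \<rho> N" and U: "continuous_on {0..} U" "convex_on {0..} U" "U 0 = 0"
    and fin: "ereal_integral \<nu> (\<lambda>x. U (\<rho> x)) + slope_at_infinity U * enn2ereal (emeasure \<mu> N) < \<infinity>"
  defines "\<kappa> \<equiv> real_of_ereal (slope_at_infinity U)"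
  shows "integrable \<nu> (\<lambda>x. U (\<rho> x))"
    and "emeasure \<mu> N \<noteq> 0 \<Longrightarrow> slope_at_infinity U = ereal \<kappa>"
    and "ereal_integral \<nu> (\<lambda>x. U (\<rho> x)) + slope_at_infinity U * enn2ereal (emeasure \<mu> N)
      = ereal ((\<integral>x. U (\<rho> x) \<partial>\<nu>) + (\<integral>x. \<kappa> * indicator N x \<partial>\<mu>))"
proof -
  interpret split_prob_pair \<mu> \<nu> \<rho> N by fact
  let ?P = "\<integral>\<^sup>+x. ennreal (U (\<rho> x)) \<partial>\<nu>" and ?Q = "\<integral>\<^sup>+x. ennreal (- U (\<rho> x)) \<partial>\<nu>"
  \<comment> \<open>\<open>U\<close> is continuous only on the half-line; composed with
    \<open>max 0\<close> it is continuous on the whole line and agrees with \<open>U\<close> at the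
    values of \<rho>.\<close>
  have "continuous_on UNIV (\<lambda>r. U (max 0 r))"
    by (rule continuous_on_compose2[OF U(1)]) (auto intro!: continuous_intros)
  then have "(\<lambda>r. U (max 0 r)) \<in> borel_measurable borel" by (rule borel_measurable_continuous_onI)
  from measurable_compose[OF \<rho>_borel this] have "(\<lambda>x. U (\<rho> x)) \<in> borel_measurable borel"
    using \<rho>_nonneg by (simp add: max_absorb2)
  then have meas: "(\<lambda>x. U (\<rho> x)) \<in> borel_measurable \<nu>"
    by (simp add: measurable_cong_sets[OF sets_\<nu> refl])
  \<comment> \<open>A single affine minorant makes the negative part of \<open>U (\<rho> x)\<close>
    integrable, so the extended integral is no difference of infinities.\<close>
  obtain a b where ab: "(a, b) \<in> affine_minorants U"
    using convex_on_subgradient[OF U(2) zero_less_one] by metis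
  have "integrable \<nu> (\<lambda>x. \<bar>a * \<rho> x + b\<bar>)" using integrable_\<rho> by simp
  then have "(\<integral>\<^sup>+x. ennreal \<bar>a * \<rho> x + b\<bar> \<partial>\<nu>) < \<infinity>"
    by (simp add: integrable_iff_bounded)
  moreover have "?Q \<le> (\<integral>\<^sup>+x. ennreal \<bar>a * \<rho> x + b\<bar> \<partial>\<nu>)"
  proof (intro nn_integral_mono ennreal_leI)
    show "- U (\<rho> x) \<le> \<bar>a * \<rho> x + b\<bar>" for x
      using affine_minorantsD[OF ab \<rho>_nonneg[of x]] by linarith
  qed
  ultimately have Q: "?Q < \<infinity>" by simp
  then obtain q where q: "?Q = ennreal q" "0 \<le> q" by (cases ?Q) auto
  have eN: "emeasure \<mu> N = ennreal (measure \<mu> N)" by (rule \<mu>.emeasure_eq_measure)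
  have not_MInf: "slope_at_infinity U \<noteq> -\<infinity>" by (rule slope_at_infinity_neq_MInf[OF U(2,3)])
  have notM: "slope_at_infinity U * enn2ereal (emeasure \<mu> N) \<noteq> -\<infinity>"
    using not_MInf by (cases "slope_at_infinity U") (auto simp: zero_less_measure_iff eN enn2ereal_ennreal)
  have P: "?P \<noteq> \<infinity>"
  proof
    assume "?P = \<infinity>"
    then have "ereal_integral \<nu> (\<lambda>x. U (\<rho> x)) = \<infinity>"
      using q by (simp add: ereal_integral_def enn2ereal_ennreal)
    with fin notM show False by simp
  qed
  show W: "integrable \<nu> (\<lambda>x. U (\<rho> x))"
    unfolding real_integrable_def using meas P Q by simp
  show slope: "slope_at_infinity U = ereal \<kappa>" if "emeasure \<mu> N \<noteq> 0"
  proof -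
    have "0 < measure \<mu> N" using that by (simp add: eN zero_less_measure_iff)
    then have "slope_at_infinity U \<noteq> \<infinity>"
      using fin by (auto simp: ereal_integral_eq[OF W] eN enn2ereal_ennreal)
    with not_MInf show ?thesis unfolding \<kappa>_def by (cases "slope_at_infinity U") auto
  qed
  have "slope_at_infinity U * enn2ereal (emeasure \<mu> N) = ereal (\<kappa> * measure \<mu> N)"
  proof (cases "emeasure \<mu> N = 0")
    case True
    then show ?thesis by (simp add: measure_def zero_ennreal.rep_eq)
  next
    case False
    show ?thesis by (simp add: slope[OF False] eN enn2ereal_ennreal)
  qed
  moreover have "(\<integral>x. \<kappa> * indicator N x \<partial>\<mu>) = \<kappa> * measure \<mu> N"
    using sets_eq_imp_space_eq[OF sets_\<mu>] by simp
  ultimately show "ereal_integral \<nu> (\<lambda>x. U (\<rho> x)) + slope_at_infinity U * enn2ereal (emeasure \<mu> N)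
      = ereal ((\<integral>x. U (\<rho> x) \<partial>\<nu>) + (\<integral>x. \<kappa> * indicator N x \<partial>\<mu>))"
    by (simp add: ereal_integral_eq[OF W])
qed

section \<open>The approximating sequence and its two limits\<close>

theorem theoremC12:
  fixes U :: "real \<Rightarrow> real" and \<nu> \<mu> :: "'a::metric_space measure"
  assumes "continuous_on {0..} U" and "convex_on {0..} U" and "U 0 = 0"
    and "compact (UNIV :: 'a set)"
    and "prob_space \<nu>" and "sets \<nu> = sets borel"
    and "\<mu> \<in> P2 \<nu>"
    and "U_functional U \<nu> \<mu> < \<infinity>"
  shows "\<exists>f :: nat \<Rightarrow> 'a \<Rightarrow> real.
    (\<forall>k. continuous_on UNIV (f k) \<and> (AE x in \<nu>. 0 \<le> f k x)
         \<and> prob_space (density \<nu> (\<lambda>x. ennreal (f k x)))) \<and>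
    weak_star_conv (\<lambda>k. density \<nu> (\<lambda>x. ennreal (f k x))) \<mu> \<and>
    (\<lambda>k. U_functional U \<nu> (density \<nu> (\<lambda>x. ennreal (f k x)))) \<longlonglongrightarrow> U_functional U \<nu> \<mu>"
proof -
  note U = assms(1-3)
  have \<mu>: "prob_space \<mu>" "sets \<mu> = sets borel" "msupport \<mu> \<subseteq> msupport \<nu>"
    using assms(7) by (auto simp: P2_def)
  have fm: "finite_measure \<nu>" "finite_measure \<mu>"
    using assms(5) \<mu>(1) by (auto simp: prob_space_def)
  have s\<mu>\<nu>: "sets \<mu> = sets \<nu>" using \<mu> assms(6) by simp
  obtain \<rho> \<mu>s where dec: "lebesgue_decomposition \<nu> \<mu> \<rho> \<mu>s"
    using lebesgue_decomposition_exists[OF fm s\<mu>\<nu>] by blast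
  obtain N where N: "N \<in> sets \<nu>" "emeasure \<nu> N = 0" "emeasure \<mu>s (space \<nu>) = emeasure \<mu> N"
    "density \<nu> (\<lambda>x. ennreal (\<rho> x)) = density \<mu> (\<lambda>x. ennreal (indicat_real (- N) x))"
    using mutually_singular_split[OF s\<mu>\<nu> dec] .
  interpret split_prob_pair \<mu> \<nu> \<rho> N
  proof (intro split_prob_pair.intro compact_prob_pair.intro split_prob_pair_axioms.intro)
    show "\<rho> \<in> borel_measurable borel"
      using dec unfolding lebesgue_decomposition_def measurable_cong_sets[OF assms(6) refl] by blast
    show "0 \<le> \<rho> x" for x using dec by (simp add: lebesgue_decomposition_def)
    show "N \<in> sets borel" using N(1) assms(6) by simp
  qed (fact assms(4,5,6) \<mu>(1,2) N(2,4))+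
  have UF: "U_functional U \<nu> \<mu> = ereal_integral \<nu> (\<lambda>x. U (\<rho> x)) + slope_at_infinity U * enn2ereal (emeasure \<mu> N)"
    using U_functional_eq[OF fm dec, of U] N(3) by simp
  define \<kappa> where "\<kappa> = real_of_ereal (slope_at_infinity U)"
  define T where "T = (\<integral>x. U (\<rho> x) \<partial>\<nu>) + (\<integral>x. \<kappa> * indicator N x \<partial>\<mu>)"
  note finite_eq = U_functional_finite_eq[OF split_prob_pair_axioms U assms(8)[unfolded UF], folded \<kappa>_def]
  note W = finite_eq(1)
  have UT: "U_functional U \<nu> \<mu> = ereal T" unfolding UF T_def by (rule finite_eq(3))
  have \<kappa>1: "a \<le> \<kappa>" if "emeasure \<mu> N \<noteq> 0" "(a, b) \<in> affine_minorants U" for a b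
    using slope_at_infinity_upper[OF U(2,3) that(2)] finite_eq(2)[OF that(1)] by simp
  have \<kappa>2: "\<exists>a b. (a, b) \<in> affine_minorants U \<and> c < a" if "emeasure \<mu> N \<noteq> 0" "c < \<kappa>" for c
    using slope_at_infinity_approx[OF U(2,3), of c] finite_eq(2)[OF that(1)] that(2) by simp
  have K: "integrable \<mu> (\<lambda>x. \<kappa> * indicat_real N x)"
    by (rule integrable_bounded(1)[of _ "\<bar>\<kappa>\<bar>"], measurable) (auto split: split_indicator)
  \<comment> \<open>The density for mesh \<open>1 / Suc k\<close>. The last clause measures
    closeness by the oscillation \<open>w\<close> of a test function at this scale, so that one
    \<open>f\<close> serves all test functions.\<close>
  have "\<exists>f. continuous_on UNIV f \<and> (\<forall>x. 0 \<le> f x) \<and> (\<integral>x. f x \<partial>\<nu>) = 1 \<and> (\<integral>x. U (f x) \<partial>\<nu>) \<le> T \<and>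
    (\<forall>\<phi> w. continuous_on UNIV \<phi> \<longrightarrow> (\<forall>x y. dist x y < 1 / Suc k \<longrightarrow> \<bar>\<phi> x - \<phi> y\<bar> \<le> w) \<longrightarrow>
      \<bar>(\<integral>x. f x * \<phi> x \<partial>\<nu>) - (\<integral>x. \<phi> x \<partial>\<mu>)\<bar> \<le> 2 * w)" for k :: nat
  proof (rule smoothing[OF \<mu>(3) _ U W K, of "1 / Suc k"])
    show "a * (\<integral>x. \<psi> x \<partial>\<mu>) + b * (\<integral>x. \<psi> x \<partial>\<nu>)
        \<le> (\<integral>x. \<psi> x * U (\<rho> x) \<partial>\<nu>) + (\<integral>x. \<psi> x * (\<kappa> * indicator N x) \<partial>\<mu>)"
      if "(a, b) \<in> affine_minorants U" "continuous_on UNIV \<psi>" "\<And>x. 0 \<le> \<psi> x" for a b \<psi>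
      by (rule minorant_bound[OF W that(1) \<kappa>1[OF _ that(1)] that(2,3)])
    fix f
    assume "continuous_on UNIV f" "\<And>x. 0 \<le> f x" "(\<integral>x. f x \<partial>\<nu>) = 1"
      "(\<integral>x. U (f x) \<partial>\<nu>) \<le> (\<integral>x. U (\<rho> x) \<partial>\<nu>) + (\<integral>x. \<kappa> * indicator N x \<partial>\<mu>)"
      "\<And>\<phi> w. continuous_on UNIV \<phi> \<Longrightarrow> (\<And>x y. dist x y < 1 / Suc k \<Longrightarrow> \<bar>\<phi> x - \<phi> y\<bar> \<le> w) \<Longrightarrow>
        \<bar>(\<integral>x. f x * \<phi> x \<partial>\<nu>) - (\<integral>x. \<phi> x \<partial>\<mu>)\<bar> \<le> 2 * w"
    then show ?thesis unfolding T_def by blast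
  qed simp
  then obtain f where f: "\<And>k. continuous_on UNIV (f k)" "\<And>k x. 0 \<le> f k x" "\<And>k. (\<integral>x. f k x \<partial>\<nu>) = 1"
    and upper: "\<And>k. (\<integral>x. U (f k x) \<partial>\<nu>) \<le> T"
    and approx: "\<And>k \<phi> w. continuous_on UNIV \<phi> \<Longrightarrow> (\<forall>x y. dist x y < 1 / Suc k \<longrightarrow> \<bar>\<phi> x - \<phi> y\<bar> \<le> w) \<Longrightarrow>
      \<bar>(\<integral>x. f k x * \<phi> x \<partial>\<nu>) - (\<integral>x. \<phi> x \<partial>\<mu>)\<bar> \<le> 2 * w"
    by metis
  have fm\<nu> [measurable]: "f k \<in> borel_measurable \<nu>" for k
    using borel_measurable_integrable[OF integrable_continuous(2)[OF f(1)]] .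
  have prob: "prob_space (density \<nu> (\<lambda>x. ennreal (f k x)))" for k
  proof (rule prob_spaceI)
    have "(\<integral>\<^sup>+x. ennreal (f k x) \<partial>\<nu>) = ennreal (\<integral>x. f k x \<partial>\<nu>)"
      by (rule nn_integral_eq_integral[OF integrable_continuous(2)[OF f(1)]]) (simp add: f(2))
    then show "emeasure (density \<nu> (\<lambda>x. ennreal (f k x))) (space (density \<nu> (\<lambda>x. ennreal (f k x)))) = 1"
      by (simp add: emeasure_density f(3))
  qed
  have lim: "(\<lambda>k. \<integral>x. f k x * \<phi> x \<partial>\<nu>) \<longlonglongrightarrow> (\<integral>x. \<phi> x \<partial>\<mu>)" if \<phi>: "continuous_on UNIV \<phi>" for \<phi>
  proof (rule LIMSEQ_I)
    fix r :: real assume r: "0 < r"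
    have "uniformly_continuous_on UNIV \<phi>" by (rule compact_uniformly_continuous[OF \<phi> compact_UNIV])
    \<comment> \<open>With \<open>w = r / 3\<close> the error bound \<open>2 * w\<close> stays
      strictly below \<open>r\<close>.\<close>
    then obtain d where d: "0 < d" "\<And>x y. dist x y < d \<Longrightarrow> dist (\<phi> x) (\<phi> y) < r / 3"
      using r unfolding uniformly_continuous_on_def by (metis UNIV_I dist_commute divide_pos_pos zero_less_numeral)
    obtain n where n: "1 / Suc n < d" using nat_approx_posE[OF d(1)] .
    have "norm ((\<integral>x. f k x * \<phi> x \<partial>\<nu>) - (\<integral>x. \<phi> x \<partial>\<mu>)) < r" if "n \<le> k" for k
    proof -
      have "1 / Suc k \<le> 1 / Suc n" using that by (simp add: field_simps)
      then have "\<forall>x y. dist x y < 1 / Suc k \<longrightarrow> \<bar>\<phi> x - \<phi> y\<bar> \<le> r / 3"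
        using d(2) n by (metis dist_real_def less_imp_le less_trans order_less_le_trans)
      from approx[OF \<phi> this] show ?thesis using r by simp
    qed
    then show "\<exists>n. \<forall>k\<ge>n. norm ((\<integral>x. f k x * \<phi> x \<partial>\<nu>) - (\<integral>x. \<phi> x \<partial>\<mu>)) < r" by blast
  qed
  have "(\<lambda>k. \<integral>x. U (f k x) \<partial>\<nu>) \<longlonglongrightarrow> T"
  \<comment> \<open>The bound from above holds for every \<open>k\<close> by construction; the one
    from below needs weak-* convergence, through a family of lines whose value exceeds
    \<open>c\<close>.\<close>
  proof (rule order_tendstoI)
    fix c assume c: "c < T"
    have "\<exists>\<alpha> \<beta>. approximable_minorant U \<mu> \<nu> \<alpha> \<beta> \<and> c < (\<integral>x. \<alpha> x \<partial>\<mu>) + (\<integral>x. \<beta> x \<partial>\<nu>)"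
      by (rule approximable_minorant_sup[OF U W _ _ c[unfolded T_def]]) (rule \<kappa>1 \<kappa>2; assumption)+
    then obtain \<alpha> \<beta> where ab: "approximable_minorant U \<mu> \<nu> \<alpha> \<beta>" "c < (\<integral>x. \<alpha> x \<partial>\<mu>) + (\<integral>x. \<beta> x \<partial>\<nu>)"
      by blast
    show "eventually (\<lambda>k. c < (\<integral>x. U (f k x) \<partial>\<nu>)) sequentially"
      by (rule approximable_minorant_liminf[OF ab(1) U(1) f(1,2) lim ab(2)])
  next
    fix c assume "T < c"
    then show "eventually (\<lambda>k. (\<integral>x. U (f k x) \<partial>\<nu>) < c) sequentially"
      by (intro always_eventually allI le_less_trans[OF upper])
  qed
  then have "(\<lambda>k. U_functional U \<nu> (density \<nu> (\<lambda>x. ennreal (f k x)))) \<longlonglongrightarrow> U_functional U \<nu> \<mu>"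
    unfolding UT U_functional_density[OF U(1) assms(4-6) f(1,2) prob] by simp
  moreover have "weak_star_conv (\<lambda>k. density \<nu> (\<lambda>x. ennreal (f k x))) \<mu>"
    unfolding weak_star_conv_def
  proof (intro allI impI)
    fix \<phi> :: "'a \<Rightarrow> real" assume \<phi>: "continuous_on UNIV \<phi>"
    have "integral\<^sup>L (density \<nu> (\<lambda>x. ennreal (f k x))) \<phi> = (\<integral>x. f k x * \<phi> x \<partial>\<nu>)" for k
      using borel_measurable_integrable[OF integrable_continuous(2)[OF \<phi>]] f(2)
      by (subst integral_density) auto
    then show "(\<lambda>k. integral\<^sup>L (density \<nu> (\<lambda>x. ennreal (f k x))) \<phi>) \<longlonglongrightarrow> integral\<^sup>L \<mu> \<phi>"
      using lim[OF \<phi>] by simp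
  qed
  ultimately show ?thesis using f(1,2) prob by (intro exI[of _ f]) simp
qed

end
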